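(* Let $A\in\mathbb{C}^{n\times n}$ be Hermitian, and let $\mathcal{X},\mathcal{Y}\subseteq\mathbb{C}^n$ be subspaces of the same dimension $k$, with orthonormal bases given by the columns of $X,Y\in\mathbb{C}^{n\times k}$ respectively, and suppose $\mathcal{X}$ or $\mathcal{Y}$ is $A$-invariant. Then $$|\lambda(X^HAX)-\lambda(Y^HAY)|\ \prec_w\ \mathrm{spr}(A)\Big[e-\cos\theta(\mathcal{X},\mathcal{Y})+\tfrac12\sin^2\theta(\mathcal{X},\mathcal{Y})\Big],$$ where $e=(1,\dots,1)^T\in\mathbb{R}^k$.
   Context: For a Hermitian matrix $M$, $\lambda(M)$ denotes the vector of its eigenvalues arranged in nonincreasing order, $\lambda_i(M)$ its $i$-th entry; for $A\in\mathbb{C}^{n\times n}$ Hermitian, $\mathrm{spr}(A)=\lambda_1(A)-\lambda_n(A)$. For any matrix $B$, $s(B)$ is the vector of singular values in nonincreasing order, and $s^{\uparrow}(B)$ the same in nondecreasing order. For subspaces $\mathcal{X},\mathcal{Y}$ of equal dimension $k$ with orthonormal-column basis matrices $X,Y$, the vector of principal angles $\theta(\mathcal{X},\mathcal{Y})\in[0,\pi/2]^k$ is arranged in nonincreasing order and defined by $\cos\theta(\mathcal{X},\mathcal{Y})=s^{\uparrow}(X^HY)$. Functions such as $\sin^2$, $\cos$, $|\cdot|$ act componentwise on vectors. For $x\in\mathbb{R}^k$, $x^{\downarrow}$ is $x$ rearranged in nonincreasing order; $x\prec_w y$ (weak submajorization) means $\sum_{i=1}^j x_i^{\downarrow}\le\sum_{i=1}^j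 y_i^{\downarrow}$ for all $1\le j\le k$. *)

theory Defs
  imports "Jordan_Normal_Form.Schur_Decomposition"
begin

definition hermitian_mat :: "complex mat \<Rightarrow> bool" where
  "hermitian_mat M \<longleftrightarrow> square_mat M \<and> mat_adjoint M = M"

definition eigvals :: "complex mat \<Rightarrow> real list" where
  "eigvals M = (THE l. length l = dim_row M \<and> sorted_wrt (\<ge>) l \<and>
      char_poly M = prod_list (map (\<lambda>x. [:- complex_of_real x, 1:]) l))"

definition spr :: "complex mat \<Rightarrow> real" where
  "spr M = hd (eigvals M) - last (eigvals M)"

(* singular values s(B) in nonincreasing order: square roots of the
   eigenvalues of B^H B (used here only for square B) *)
definition sing_vals :: "complex mat \<Rightarrow> real list" where
  "sing_vals B = map sqrt (eigvals (mat_adjoint B * B))"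

definition sing_vals_up :: "complex mat \<Rightarrow> real list" where
  "sing_vals_up B = rev (sing_vals B)"

definition orthonormal_cols :: "complex mat \<Rightarrow> bool" where
  "orthonormal_cols X \<longleftrightarrow> mat_adjoint X * X = 1\<^sub>m (dim_col X)"

definition col_space :: "complex mat \<Rightarrow> complex vec set" where
  "col_space X = {X *\<^sub>v c | c. c \<in> carrier_vec (dim_col X)}"

definition invariant_subspace :: "complex mat \<Rightarrow> complex vec set \<Rightarrow> bool" where
  "invariant_subspace A S \<longleftrightarrow> (\<forall>v\<in>S. A *\<^sub>v v \<in> S)"

definition principal_angles :: "complex mat \<Rightarrow> complex mat \<Rightarrow> real list" where
  "principal_angles X Y = map arccos (sing_vals_up (mat_adjoint X * Y))"

definition sort_desc :: "real list \<Rightarrow> real list" where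
  "sort_desc x = rev (sort x)"

definition weak_submaj :: "real list \<Rightarrow> real list \<Rightarrow> bool" where
  "weak_submaj x y \<longleftrightarrow> length x = length y \<and>
     (\<forall>j\<in>{1..length x}. sum_list (take j (sort_desc x)) \<le> sum_list (take j (sort_desc y)))"

end

theory Submission
  imports Defs "Jordan_Normal_Form.Spectral_Radius"
begin

text \<open>
  By symmetry the column space of \<open>X\<close> may be assumed invariant. A singular value decomposition of
  \<open>X\<^sup>H Y\<close> lets us assume \<open>X\<^sup>H Y = C = diag(cos \<theta>)\<close>, so that \<open>Y = X C + Z\<close> with
  \<open>X\<^sup>H Z = 0\<close> and \<open>Z\<^sup>H Z = 1 - C\<^sup>2\<close>. Write \<open>A = m + r B\<close> with \<open>r = spr A / 2\<close> and a
  Hermitian contraction \<open>B\<close>, and \<open>B\<^sub>1 = X\<^sup>H B X\<close>. By invariance the cross terms vanish, hence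
  \<open>D = X\<^sup>H A X - Y\<^sup>H A Y = r (B\<^sub>1 - C B\<^sub>1 C - Z\<^sup>H B Z)\<close>, where
  \<open>B\<^sub>1 - C B\<^sub>1 C = E K + K\<^sup>H E\<close> for \<open>E = 1 - C\<close> and the contraction \<open>K = B\<^sub>1 (1 + C) / 2\<close>.
  Mirsky's inequality reduces the claim to estimating the sum of \<open>|v\<^sup>H D v|\<close> over orthonormal
  vectors \<open>v\<close>; the two parts of \<open>D\<close> contribute at most the largest values of
  \<open>2 r (1 - cos \<theta>)\<close> and of \<open>r sin\<^sup>2 \<theta>\<close>.
\<close>

lemma carrier_mat_iff: "M \<in> carrier_mat n m \<longleftrightarrow> dim_row M = n \<and> dim_col M = m"
  by auto

text \<open>Membership in carriers is rewritten to equations between dimensions, so that the simplifier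
  discharges the side conditions of the matrix laws below.\<close>

declare carrier_vecD[simp del] carrier_matD[simp del] carrier_dim_vec[simp] carrier_mat_iff[simp]
  index_mult_mat(1)[simp del] index_mult_mat_vec[simp del]

subsection \<open>Adjoints and inner products\<close>

definition norm_sq :: "complex vec \<Rightarrow> real" where
  "norm_sq v = (\<Sum>i<dim_vec v. (cmod (v $ i))\<^sup>2)"

definition quad_form :: "complex mat \<Rightarrow> complex vec \<Rightarrow> real" where
  "quad_form M v = Re ((M *\<^sub>v v) \<bullet>c v)"

lemma mult_mat_assoc:
  "dim_col A = dim_row B \<Longrightarrow> dim_col B = dim_row C \<Longrightarrow> A * B * C = A * (B * C)"
  by (rule assoc_mult_mat) auto

lemma mult_mat_vec_assoc:
  "dim_col A = dim_row B \<Longrightarrow> dim_col B = dim_vec v \<Longrightarrow> A * B *\<^sub>v v = A *\<^sub>v (B *\<^sub>v v)"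
  by (rule assoc_mult_mat_vec) auto

lemma mat_adjoint_dim[simp]:
  "dim_row (mat_adjoint (M :: complex mat)) = dim_col M"
  "dim_col (mat_adjoint (M :: complex mat)) = dim_row M"
  by (simp_all add: mat_adjoint_def)

lemma mat_adjoint_index[simp]:
  "i < dim_col M \<Longrightarrow> j < dim_row M \<Longrightarrow> mat_adjoint (M :: complex mat) $$ (i, j) = cnj (M $$ (j, i))"
  by (simp add: mat_adjoint_def mat_of_rows_def)

lemma mat_adjoint_adjoint[simp]: "mat_adjoint (mat_adjoint M) = (M :: complex mat)"
  by (rule eq_matI) auto

lemma mat_adjoint_one[simp]: "mat_adjoint (1\<^sub>m n) = (1\<^sub>m n :: complex mat)"
  by (rule eq_matI) auto

lemma row_mat_adjoint[simp]:
  "i < dim_col M \<Longrightarrow> row (mat_adjoint (M :: complex mat)) i = conjugate (col M i)"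
  by (intro eq_vecI) auto

lemma col_mat_adjoint[simp]:
  "i < dim_row M \<Longrightarrow> col (mat_adjoint (M :: complex mat)) i = conjugate (row M i)"
  by (intro eq_vecI) auto

lemma cscalar_prod_cnj:
  "dim_vec v = dim_vec w \<Longrightarrow> v \<bullet>c w = cnj (w \<bullet>c (v :: complex vec))"
  by (simp add: scalar_prod_def mult.commute)

lemma mat_adjoint_mult_index:
  assumes "dim_row V = dim_row W" "i < dim_col V" "j < dim_col W"
  shows "(mat_adjoint V * W) $$ (i, j) = col W j \<bullet>c col (V :: complex mat) i"
  using assms by (simp add: index_mult_mat conjugate_vec_sprod_comm[of _ "dim_row V"])

lemma mat_adjoint_mult_vec_index:
  assumes "dim_vec v = dim_row V" "i < dim_col V"
  shows "(mat_adjoint V *\<^sub>v v) $ i = v \<bullet>c col (V :: complex mat) i"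
  using assms by (simp add: index_mult_mat_vec conjugate_vec_sprod_comm[of _ "dim_row V"])

lemma mat_adjoint_mult:
  assumes "dim_col P = dim_row Q"
  shows "mat_adjoint (P * Q) = mat_adjoint Q * mat_adjoint (P :: complex mat)"
  using assms
  by (intro eq_matI) (auto simp: mat_adjoint_mult_index index_mult_mat scalar_prod_def mult.commute)

lemma mat_adjoint_add:
  "dim_row P = dim_row Q \<Longrightarrow> dim_col P = dim_col Q \<Longrightarrow>
    mat_adjoint (P + Q) = mat_adjoint P + mat_adjoint (Q :: complex mat)"
  by (rule eq_matI) auto

lemma mat_adjoint_minus:
  "dim_row P = dim_row Q \<Longrightarrow> dim_col P = dim_col Q \<Longrightarrow>
    mat_adjoint (P - Q) = mat_adjoint P - mat_adjoint (Q :: complex mat)"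
  by (rule eq_matI) auto

lemma cscalar_prod_mult_mat_vec:
  fixes M :: "complex mat"
  assumes "dim_vec v = dim_col M" "dim_vec w = dim_row M"
  shows "(M *\<^sub>v v) \<bullet>c w = v \<bullet>c (mat_adjoint M *\<^sub>v w)"
proof -
  have "(M *\<^sub>v v) \<bullet>c w = (\<Sum>i<dim_row M. \<Sum>j<dim_col M. M $$ (i, j) * v $ j * cnj (w $ i))"
    using assms by (simp add: scalar_prod_def index_mult_mat_vec sum_distrib_right atLeast0LessThan)
  also have "\<dots> = (\<Sum>j<dim_col M. \<Sum>i<dim_row M. M $$ (i, j) * v $ j * cnj (w $ i))"
    by (rule sum.swap)
  also have "\<dots> = v \<bullet>c (mat_adjoint M *\<^sub>v w)"
    using assms
    by (simp add: scalar_prod_def index_mult_mat_vec sum_distrib_left mult_ac atLeast0LessThan)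
  finally show ?thesis .
qed

lemma cscalar_prod_self: "v \<bullet>c v = complex_of_real (norm_sq v)"
  by (simp add: norm_sq_def scalar_prod_def complex_norm_square atLeast0LessThan del: of_real_power)

lemma norm_sq_nonneg[simp]: "0 \<le> norm_sq v"
  by (simp add: norm_sq_def sum_nonneg)

lemma norm_sq_eq_0_iff: "v \<in> carrier_vec n \<Longrightarrow> norm_sq v = 0 \<longleftrightarrow> v = 0\<^sub>v n"
  by (metis conjugate_square_eq_0_vec cscalar_prod_self of_real_eq_0_iff)

lemma norm_sq_smult: "norm_sq (a \<cdot>\<^sub>v v) = (cmod a)\<^sup>2 * norm_sq v"
  by (simp add: norm_sq_def norm_mult power_mult_distrib sum_distrib_left)

lemma norm_sq_unit_vec[simp]: "p < n \<Longrightarrow> norm_sq (unit_vec n p) = 1"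
  by (simp add: norm_sq_def if_distrib[of "\<lambda>x. (cmod x)\<^sup>2"] cong: if_cong)

lemma quad_form_one: "v \<in> carrier_vec n \<Longrightarrow> quad_form (1\<^sub>m n) v = norm_sq v"
  by (simp add: quad_form_def cscalar_prod_self)

lemma Re_cscalar_prod_le:
  assumes "dim_vec v = dim_vec w"
  shows "\<bar>2 * Re (v \<bullet>c w)\<bar> \<le> norm_sq v + norm_sq w"
proof -
  have "\<bar>2 * Re (v $ i * cnj (w $ i))\<bar> \<le> (cmod (v $ i))\<^sup>2 + (cmod (w $ i))\<^sup>2" for i
  proof -
    have "\<bar>Re (v $ i * cnj (w $ i))\<bar> \<le> cmod (v $ i) * cmod (w $ i)"
      using abs_Re_le_cmod[of "v $ i * cnj (w $ i)"] by (simp add: norm_mult)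
    then show ?thesis using sum_squares_bound[of "cmod (v $ i)" "cmod (w $ i)"] by linarith
  qed
  then have "\<bar>\<Sum>i<dim_vec w. 2 * Re (v $ i * cnj (w $ i))\<bar> \<le>
      (\<Sum>i<dim_vec w. (cmod (v $ i))\<^sup>2 + (cmod (w $ i))\<^sup>2)"
    by (intro order_trans[OF sum_abs] sum_mono)
  then show ?thesis
    using assms
    by (simp add: norm_sq_def scalar_prod_def atLeast0LessThan sum.distrib flip: sum_distrib_left)
qed

lemma quad_form_add_mat:
  assumes "M \<in> carrier_mat n n" "N \<in> carrier_mat n n" "v \<in> carrier_vec n"
  shows "quad_form (M + N) v = quad_form M v + quad_form N v"
  using assms
  by (simp add: quad_form_def add_mult_distrib_mat_vec[of _ n n] add_scalar_prod_distrib[of _ n])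

lemma quad_form_diff_mat:
  assumes "M \<in> carrier_mat n n" "N \<in> carrier_mat n n" "v \<in> carrier_vec n"
  shows "quad_form (M - N) v = quad_form M v - quad_form N v"
  using assms
  by (simp add: quad_form_def minus_mult_distrib_mat_vec[of _ n n]
      minus_scalar_prod_distrib[of _ n])

lemma quad_form_congruence:
  assumes "A \<in> carrier_mat n n" "X \<in> carrier_mat n k" "v \<in> carrier_vec k"
  shows "quad_form (mat_adjoint X * A * X) v = quad_form A (X *\<^sub>v v)"
  using assms
  by (simp add: quad_form_def mult_mat_vec_assoc cscalar_prod_mult_mat_vec[of _ "mat_adjoint X"])

lemma hermitian_mat_congruence:
  assumes "hermitian_mat A" "dim_row X = dim_row A"
  shows "hermitian_mat (mat_adjoint X * A * X)"
  using assms by (simp add: hermitian_mat_def mat_adjoint_mult mult_mat_assoc)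

lemma hermitian_cscalar_prod:
  assumes "hermitian_mat M" "dim_vec u = dim_row M" "dim_vec v = dim_row M"
  shows "(M *\<^sub>v u) \<bullet>c v = u \<bullet>c (M *\<^sub>v v)"
  using assms by (simp add: hermitian_mat_def cscalar_prod_mult_mat_vec)

lemma quad_form_add_orthogonal:
  assumes M: "M \<in> carrier_mat n n" "hermitian_mat M" and u: "u \<in> carrier_vec n"
    and v: "v \<in> carrier_vec n"
    and orth: "(M *\<^sub>v u) \<bullet>c v = 0"
  shows "quad_form M (u + v) = quad_form M u + quad_form M v"
proof -
  have "(M *\<^sub>v v) \<bullet>c u = 0"
    using M u v orth hermitian_cscalar_prod[of M v u] cscalar_prod_cnj[of v "M *\<^sub>v u"] by simp
  with assms show ?thesis
    by (simp add: quad_form_def mult_add_distrib_mat_vec conjugate_add_vec[of _ n]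
        add_scalar_prod_distrib[of _ n] scalar_prod_add_distrib[of _ n])
qed

lemma quad_form_diff_vec:
  assumes M: "M \<in> carrier_mat n n" "hermitian_mat M" and u: "u \<in> carrier_vec n"
    and v: "v \<in> carrier_vec n"
  shows "quad_form M u - quad_form M v = Re ((M *\<^sub>v (u + v)) \<bullet>c (u - v))"
proof -
  have Re_swap: "Re ((M *\<^sub>v v) \<bullet>c u) = Re ((M *\<^sub>v u) \<bullet>c v)"
    using M u v hermitian_cscalar_prod[of M v u] cscalar_prod_cnj[of v "M *\<^sub>v u"] by simp
  have "conjugate (u - v) = conjugate u - conjugate v" using u v by (intro eq_vecI) auto
  with M u v Re_swap show ?thesis
    by (simp add: quad_form_def mult_add_distrib_mat_vec
        add_scalar_prod_distrib[of _ n] scalar_prod_minus_distrib[of _ n])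
qed

subsection \<open>Orthonormal families\<close>

definition orthonormal_on :: "nat set \<Rightarrow> (nat \<Rightarrow> complex vec) \<Rightarrow> bool" where
  "orthonormal_on P u \<longleftrightarrow> (\<forall>i\<in>P. \<forall>j\<in>P. u i \<bullet>c u j = (if i = j then 1 else 0))"

lemma orthonormal_cols_iff: "orthonormal_cols V \<longleftrightarrow> orthonormal_on {..<dim_col V} (col V)"
proof
  assume V: "orthonormal_cols V"
  have "col V i \<bullet>c col V j = 1\<^sub>m (dim_col V) $$ (j, i)" if "i < dim_col V" "j < dim_col V" for i j
    using that V by (simp add: orthonormal_cols_def flip: mat_adjoint_mult_index)
  then show "orthonormal_on {..<dim_col V} (col V)" by (simp add: orthonormal_on_def)
next
  assume "orthonormal_on {..<dim_col V} (col V)"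
  then show "orthonormal_cols V"
    unfolding orthonormal_cols_def orthonormal_on_def
    by (intro eq_matI) (auto simp: mat_adjoint_mult_index)
qed

lemma orthonormal_on_reindex:
  assumes "orthonormal_on P u" "inj_on f Q" "f ` Q \<subseteq> P"
  shows "orthonormal_on Q (\<lambda>i. u (f i))"
  using assms by (auto simp: orthonormal_on_def inj_on_eq_iff image_subset_iff)

lemma orthonormal_cols_mat_of_cols:
  assumes "orthonormal_on {..<m} u" "\<And>i. i < m \<Longrightarrow> u i \<in> carrier_vec n"
  shows "orthonormal_cols (mat_of_cols n (map u [0..<m]))"
  using assms by (auto simp: orthonormal_cols_iff orthonormal_on_def)

lemma orthonormal_cols_cancel:
  assumes "orthonormal_cols V" "dim_row M = dim_col V"
  shows "mat_adjoint V * (V * M) = M"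
  using assms by (simp add: orthonormal_cols_def flip: mult_mat_assoc)

lemma orthonormal_cols_cancel_vec:
  assumes "orthonormal_cols V" "dim_vec v = dim_col V"
  shows "mat_adjoint V *\<^sub>v (V *\<^sub>v v) = v"
  using assms by (simp add: orthonormal_cols_def flip: mult_mat_vec_assoc)

lemma orthonormal_cols_mult:
  assumes "orthonormal_cols V" "orthonormal_cols W" "dim_col V = dim_row W"
  shows "orthonormal_cols (V * W)"
  using assms
  by (simp add: orthonormal_cols_def mat_adjoint_mult mult_mat_assoc orthonormal_cols_cancel)

lemma orthonormal_cols_right_inverse:
  assumes "U \<in> carrier_mat n n" "orthonormal_cols U"
  shows "U * mat_adjoint U = 1\<^sub>m n"
  using assms mat_mult_left_right_inverse[of "mat_adjoint U" n U]
  by (simp add: orthonormal_cols_def)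

lemma orthonormal_cols_adjoint:
  assumes "U \<in> carrier_mat n n" "orthonormal_cols U"
  shows "orthonormal_cols (mat_adjoint U)"
  using assms by (simp add: orthonormal_cols_def orthonormal_cols_right_inverse)

lemma norm_sq_orthonormal_cols:
  assumes "orthonormal_cols V" "v \<in> carrier_vec (dim_col V)"
  shows "norm_sq (V *\<^sub>v v) = norm_sq v"
proof -
  have "(V *\<^sub>v v) \<bullet>c (V *\<^sub>v v) = v \<bullet>c v"
    using assms by (simp add: cscalar_prod_mult_mat_vec orthonormal_cols_cancel_vec)
  then show ?thesis by (simp add: cscalar_prod_self)
qed

lemma norm_sq_col:
  assumes "orthonormal_cols V" "i < dim_col V"
  shows "norm_sq (col V i) = 1"
  using assms cscalar_prod_self[of "col V i"] by (simp add: orthonormal_cols_iff orthonormal_on_def)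

lemma parseval:
  assumes "U \<in> carrier_mat n n" "orthonormal_cols U" "v \<in> carrier_vec n"
  shows "(\<Sum>i<n. (cmod (v \<bullet>c col U i))\<^sup>2) = norm_sq v"
proof -
  have "norm_sq v = norm_sq (mat_adjoint U *\<^sub>v v)"
    using assms by (simp add: norm_sq_orthonormal_cols orthonormal_cols_adjoint)
  then show ?thesis
    using assms by (simp add: norm_sq_def[of "mat_adjoint U *\<^sub>v v"] mat_adjoint_mult_vec_index)
qed

lemma norm_sq_normalize:
  assumes "v \<in> carrier_vec n" "v \<noteq> 0\<^sub>v n"
  shows "norm_sq (complex_of_real (1 / sqrt (norm_sq v)) \<cdot>\<^sub>v v) = 1"
  using assms by (simp add: norm_sq_smult norm_sq_eq_0_iff power_divide del: of_real_divide)

lemma exists_kernel_vec: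
  fixes M :: "'a :: idom mat"
  assumes M: "M \<in> carrier_mat m n" and "m < n"
  obtains v where "v \<in> carrier_vec n" "v \<noteq> 0\<^sub>v n" "M *\<^sub>v v = 0\<^sub>v m"
proof -
  define N where "N = Matrix.mat n n (\<lambda>(i, j). if i < m then M $$ (i, j) else 0)"
  have N: "N \<in> carrier_mat n n" by (simp add: N_def)
  have "transpose_mat N *\<^sub>v unit_vec n (n - 1) = 0\<^sub>v n"
    using \<open>m < n\<close> by (intro eq_vecI) (auto simp: N_def index_mult_mat_vec)
  moreover have "unit_vec n (n - 1) \<noteq> (0\<^sub>v n :: 'a vec)"
    using \<open>m < n\<close> by (intro unit_vec_nonzero) simp
  ultimately have "det (transpose_mat N) = 0"
    using N by (subst det_0_iff_vec_prod_zero[of _ n]) (auto intro!: exI[of _ "unit_vec n (n - 1)"])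
  then have "det N = 0" using det_transpose[OF N] by simp
  then obtain v where v: "v \<in> carrier_vec n" "v \<noteq> 0\<^sub>v n" "N *\<^sub>v v = 0\<^sub>v n"
    using det_0_iff_vec_prod_zero[OF N] by auto
  have "row M i = row N i" if "i < m" for i
    using that M \<open>m < n\<close> by (intro eq_vecI) (auto simp: N_def)
  then have "(M *\<^sub>v v) $ i = (N *\<^sub>v v) $ i" if "i < m" for i
    using that M N \<open>m < n\<close> by (simp add: index_mult_mat_vec)
  then have "M *\<^sub>v v = 0\<^sub>v m" using M v(3) \<open>m < n\<close> by (intro eq_vecI) auto
  with v show ?thesis using that by blast
qed

lemma exists_unit_orthogonal:
  fixes S :: "complex vec set"
  assumes S: "S \<subseteq> carrier_vec n" "finite S" "card S < n"
  obtains x where "x \<in> carrier_vec n" "norm_sq x = 1" "\<And>u. u \<in> S \<Longrightarrow> x \<bullet>c u = 0"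
proof -
  obtain us where us: "set us = S" "length us = card S"
    using finite_distinct_list[OF S(2)] distinct_card by metis
  define V where "V = mat_of_cols n us"
  have V: "V \<in> carrier_mat n (card S)" using us by (simp add: V_def)
  obtain v where v: "v \<in> carrier_vec n" "v \<noteq> 0\<^sub>v n" "mat_adjoint V *\<^sub>v v = 0\<^sub>v (card S)"
    using exists_kernel_vec[of "mat_adjoint V" "card S" n] V S(3) by auto
  have orth: "v \<bullet>c u = 0" if "u \<in> S" for u
  proof -
    obtain i where i: "i < card S" "us ! i = u" using \<open>u \<in> S\<close> us by (metis in_set_conv_nth)
    then have "col V i = u" using S(1) \<open>u \<in> S\<close> us by (auto simp: V_def)
    then show ?thesis using mat_adjoint_mult_vec_index[of v V i] v V i by simp
  qed
  show ?thesis
    using v norm_sq_normalize[OF v(1,2)] orth S(1)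
    by (intro that[of "complex_of_real (1 / sqrt (norm_sq v)) \<cdot>\<^sub>v v"]) auto
qed

lemma orthonormal_on_extend:
  assumes "orthonormal_on P u" "P \<subseteq> {..<n}" "\<And>i. i \<in> P \<Longrightarrow> u i \<in> carrier_vec n"
  obtains u' where "orthonormal_on {..<n} u'" "\<And>i. i < n \<Longrightarrow> u' i \<in> carrier_vec n"
    "\<And>i. i \<in> P \<Longrightarrow> u' i = u i"
proof -
  have "\<exists>u'. orthonormal_on {..<n} u' \<and> (\<forall>i<n. u' i \<in> carrier_vec n) \<and> (\<forall>i\<in>P. u' i = u i)"
    using assms
  proof (induction "card ({..<n} - P)" arbitrary: P u)
    case 0
    then show ?case by (intro exI[of _ u]) auto
  next
    case (Suc d)
    then obtain p where p: "p < n" "p \<notin> P"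
      by (metis Diff_eq_empty_iff card.empty lessThan_iff nat.distinct(1) subsetI)
    have finite_P: "finite P" using Suc.prems(2) finite_subset by blast
    have "card (u ` P) \<le> card P" by (rule card_image_le[OF finite_P])
    also have "\<dots> < n" using psubset_card_mono[of "{..<n}" P] Suc.prems(2) p by auto
    finally obtain x where x: "x \<in> carrier_vec n" "norm_sq x = 1" "\<And>i. i \<in> P \<Longrightarrow> x \<bullet>c u i = 0"
      using exists_unit_orthogonal[of "u ` P" n] Suc.prems(3) finite_P
      by (metis finite_imageI image_eqI image_subsetI)
    then have "u i \<bullet>c x = 0" if "i \<in> P" for i
      using that Suc.prems(3)[of i] cscalar_prod_cnj[of "u i" x] by simp
    moreover have "x \<bullet>c x = 1" using x(2) by (simp add: cscalar_prod_self)
    ultimately have "orthonormal_on (insert p P) (u(p := x))"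
      using x(3) p(2) Suc.prems(1) by (auto simp: orthonormal_on_def)
    moreover have "d = card ({..<n} - insert p P)"
      using Suc.hyps(2) p by (simp add: card_Diff_insert)
    ultimately show ?case
      using Suc.hyps(1)[of "insert p P" "u(p := x)"] Suc.prems p x(1)
      by (metis (no_types, lifting) fun_upd_apply insert_iff insert_subset lessThan_iff)
  qed
  then show ?thesis using that by blast
qed

subsection \<open>The spectral theorem\<close>

definition real_diag :: "nat \<Rightarrow> (nat \<Rightarrow> real) \<Rightarrow> complex mat" where
  "real_diag n f = mat_diag n (\<lambda>i. complex_of_real (f i))"

definition spectral_mat :: "complex mat \<Rightarrow> (nat \<Rightarrow> real) \<Rightarrow> complex mat" where
  "spectral_mat U l = U * real_diag (dim_col U) l * mat_adjoint U"

lemma real_diag_dim[simp]: "dim_row (real_diag n f) = n" "dim_col (real_diag n f) = n"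
  by (simp_all add: real_diag_def mat_diag_def)

lemma real_diag_index:
  "i < n \<Longrightarrow> j < n \<Longrightarrow> real_diag n f $$ (i, j) = (if i = j then complex_of_real (f j) else 0)"
  by (simp add: real_diag_def mat_diag_def)

lemma mat_adjoint_real_diag[simp]: "mat_adjoint (real_diag n f) = real_diag n f"
  by (intro eq_matI) (auto simp: real_diag_index)

lemma real_diag_mult: "real_diag n f * real_diag n g = real_diag n (\<lambda>i. f i * g i)"
  by (simp add: real_diag_def)

lemma real_diag_mult_mat:
  "dim_row M = n \<Longrightarrow> real_diag n f * (real_diag n g * M) = real_diag n (\<lambda>i. f i * g i) * M"
  by (subst mult_mat_assoc[symmetric]) (simp_all add: real_diag_mult)

lemma mult_real_diag_index:
  "M \<in> carrier_mat m n \<Longrightarrow> i < m \<Longrightarrow> j < n \<Longrightarrow>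
    (M * real_diag n f) $$ (i, j) = M $$ (i, j) * complex_of_real (f j)"
  by (simp add: real_diag_def mat_diag_mult_right[of _ m])

lemma real_diag_mult_vec_index:
  assumes "v \<in> carrier_vec n" "i < n"
  shows "(real_diag n f *\<^sub>v v) $ i = complex_of_real (f i) * v $ i"
proof -
  have "row (real_diag n f) i = complex_of_real (f i) \<cdot>\<^sub>v unit_vec n i"
    using assms(2) by (intro eq_vecI) (auto simp: real_diag_index)
  then show ?thesis using assms by (simp add: index_mult_mat_vec)
qed

lemma norm_sq_real_diag:
  assumes "v \<in> carrier_vec n"
  shows "norm_sq (real_diag n f *\<^sub>v v) = (\<Sum>i<n. (f i)\<^sup>2 * (cmod (v $ i))\<^sup>2)"
  using assms by (simp add: norm_sq_def real_diag_mult_vec_index norm_mult power_mult_distrib)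

lemma quad_form_real_diag:
  assumes "v \<in> carrier_vec n"
  shows "quad_form (real_diag n f) v = (\<Sum>i<n. f i * (cmod (v $ i))\<^sup>2)"
proof -
  have "(real_diag n f *\<^sub>v v) \<bullet>c v = (\<Sum>i<n. complex_of_real (f i * (cmod (v $ i))\<^sup>2))"
    using assms
    by (simp add: scalar_prod_def real_diag_mult_vec_index complex_norm_square mult.assoc
        atLeast0LessThan del: of_real_power)
  then show ?thesis by (simp add: quad_form_def)
qed

lemma norm_sq_diff_real_diag:
  assumes "v \<in> carrier_vec n"
  shows "norm_sq v - norm_sq (real_diag n f *\<^sub>v v) = quad_form (real_diag n (\<lambda>i. 1 - (f i)\<^sup>2)) v"
  using assms
  by (simp add: norm_sq_real_diag quad_form_real_diag norm_sq_def[of v] left_diff_distrib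
      sum_subtractf)

lemma spectral_mat_dim[simp]:
  "dim_row (spectral_mat U l) = dim_row U" "dim_col (spectral_mat U l) = dim_row U"
  by (simp_all add: spectral_mat_def)

lemma hermitian_spectral_mat: "hermitian_mat (spectral_mat U l)"
  by (simp add: hermitian_mat_def spectral_mat_def mat_adjoint_mult mult_mat_assoc)

lemma quad_form_spectral_mat:
  assumes "U \<in> carrier_mat n m" "v \<in> carrier_vec n"
  shows "quad_form (spectral_mat U l) v = (\<Sum>i<m. l i * (cmod (v \<bullet>c col U i))\<^sup>2)"
proof -
  have "quad_form (spectral_mat U l) v = quad_form (real_diag m l) (mat_adjoint U *\<^sub>v v)"
    using assms quad_form_congruence[of "real_diag m l" m "mat_adjoint U" n v]
    by (simp add: spectral_mat_def)
  then show ?thesis using assms by (simp add: quad_form_real_diag mat_adjoint_mult_vec_index)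
qed

lemma quad_form_spectral_mat_const:
  assumes "U \<in> carrier_mat n n" "orthonormal_cols U" "v \<in> carrier_vec n"
  shows "quad_form (spectral_mat U (\<lambda>_. a)) v = a * norm_sq v"
  using assms by (simp add: quad_form_spectral_mat parseval flip: sum_distrib_left)

lemma quad_form_spectral_mat_mono:
  assumes "U \<in> carrier_mat n m" "v \<in> carrier_vec n"
    and "\<And>i. i < m \<Longrightarrow> v \<bullet>c col U i \<noteq> 0 \<Longrightarrow> f i \<le> g i"
  shows "quad_form (spectral_mat U f) v \<le> quad_form (spectral_mat U g) v"
proof -
  have "f i * (cmod (v \<bullet>c col U i))\<^sup>2 \<le> g i * (cmod (v \<bullet>c col U i))\<^sup>2" if "i < m" for i
    using assms(3)[OF that] by (cases "v \<bullet>c col U i = 0") (simp_all add: mult_right_mono)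
  then show ?thesis using assms(1,2) by (auto simp: quad_form_spectral_mat intro!: sum_mono)
qed

lemma quad_form_spectral_mat_col:
  assumes "U \<in> carrier_mat n m" "orthonormal_cols U" "j < m"
  shows "quad_form (spectral_mat U l) (col U j) = l j"
proof -
  have "l i * (cmod (col U j \<bullet>c col U i))\<^sup>2 = (if i = j then l j else 0)" if "i < m" for i
    using assms that by (auto simp: orthonormal_cols_iff orthonormal_on_def)
  then show ?thesis using assms by (simp add: quad_form_spectral_mat)
qed

lemma exists_unit_eigenvector:
  assumes M: "M \<in> carrier_mat n n" and "0 < n"
  obtains v e where "v \<in> carrier_vec n" "norm_sq v = 1" "M *\<^sub>v v = e \<cdot>\<^sub>v v"
proof -
  obtain e where "e \<in> spectrum M" using spectrum_non_empty[OF assms] by auto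
  then obtain v where v: "v \<in> carrier_vec n" "v \<noteq> 0\<^sub>v n" "M *\<^sub>v v = e \<cdot>\<^sub>v v"
    using M by (auto simp: spectrum_def eigenvalue_def eigenvector_def)
  let ?a = "complex_of_real (1 / sqrt (norm_sq v))"
  have "M *\<^sub>v (?a \<cdot>\<^sub>v v) = e \<cdot>\<^sub>v (?a \<cdot>\<^sub>v v)"
    using M v by (simp add: mult_mat_vec[of _ n n] smult_smult_assoc mult.commute)
  then show ?thesis using v(1) norm_sq_normalize[OF v(1,2)] by (intro that[of "?a \<cdot>\<^sub>v v" e]) auto
qed

lemma orthonormal_cols_eq_0:
  assumes "U \<in> carrier_mat n n" "orthonormal_cols U" "v \<in> carrier_vec n"
    and "\<And>i. i < n \<Longrightarrow> v \<bullet>c col U i = 0"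
  shows "v = 0\<^sub>v n"
  using assms parseval[OF assms(1-3)] by (simp add: norm_sq_eq_0_iff)

lemma exists_orthogonal_complement:
  assumes u: "orthonormal_on {..<m} u" "\<And>i. i < m \<Longrightarrow> u i \<in> carrier_vec n" and "m \<le> n"
  obtains W where "W \<in> carrier_mat n (n - m)" "orthonormal_cols W"
    "\<And>i. i < m \<Longrightarrow> mat_adjoint W *\<^sub>v u i = 0\<^sub>v (n - m)"
    "\<And>y. \<lbrakk>y \<in> carrier_vec n; \<And>i. i < m \<Longrightarrow> y \<bullet>c u i = 0; mat_adjoint W *\<^sub>v y = 0\<^sub>v (n - m)\<rbrakk>
      \<Longrightarrow> y = 0\<^sub>v n"
proof -
  obtain w where w: "orthonormal_on {..<n} w" "\<And>i. i < n \<Longrightarrow> w i \<in> carrier_vec n"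
    and wu: "\<And>i. i < m \<Longrightarrow> w i = u i"
    using orthonormal_on_extend[OF u(1), of n] u(2) \<open>m \<le> n\<close>
    by (metis lessThan_iff lessThan_subset_iff)
  define U where "U = mat_of_cols n (map w [0..<n])"
  define W where "W = mat_of_cols n (map (\<lambda>i. w (m + i)) [0..<n - m])"
  have U: "U \<in> carrier_mat n n" "orthonormal_cols U"
    using orthonormal_cols_mat_of_cols[OF w] by (simp_all add: U_def)
  have "orthonormal_on {..<n - m} (\<lambda>i. w (m + i))" by (rule orthonormal_on_reindex[OF w(1)]) auto
  then have W: "W \<in> carrier_mat n (n - m)" "orthonormal_cols W"
    using orthonormal_cols_mat_of_cols[of "n - m" "\<lambda>i. w (m + i)" n] w(2) by (simp_all add: W_def)
  have colU: "col U i = w i" if "i < n" for i using that w(2) by (simp add: U_def)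
  have colW: "col W i = w (m + i)" if "i < n - m" for i using that w(2) by (simp add: W_def)
  show ?thesis
  proof (rule that[OF W])
    show "mat_adjoint W *\<^sub>v u i = 0\<^sub>v (n - m)" if "i < m" for i
      using that W(1) w colW
      by (intro eq_vecI) (auto simp: mat_adjoint_mult_vec_index orthonormal_on_def simp flip: wu)
    show "y = 0\<^sub>v n"
      if y: "y \<in> carrier_vec n" "\<And>i. i < m \<Longrightarrow> y \<bullet>c u i = 0" "mat_adjoint W *\<^sub>v y = 0\<^sub>v (n - m)" for y
    proof (rule orthonormal_cols_eq_0[OF U y(1)])
      fix i assume i: "i < n"
      show "y \<bullet>c col U i = 0"
      proof (cases "i < m")
        case True
        then show ?thesis using i y(2) wu colU by simp
      next
        case False
        then have "y \<bullet>c col W (i - m) = 0"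
          using i y W(1) by (simp flip: mat_adjoint_mult_vec_index)
        then show ?thesis using False i colU colW by simp
      qed
    qed
  qed
qed

lemma hermitian_exists_orthogonal_eigenvector:
  assumes A: "A \<in> carrier_mat n n" "hermitian_mat A"
    and u: "orthonormal_on {..<m} u" "\<And>i. i < m \<Longrightarrow> u i \<in> carrier_vec n"
    and eigenvector: "\<And>i. i < m \<Longrightarrow> \<exists>e. A *\<^sub>v u i = e \<cdot>\<^sub>v u i" and "m < n"
  obtains v e where "v \<in> carrier_vec n" "norm_sq v = 1" "\<And>i. i < m \<Longrightarrow> v \<bullet>c u i = 0"
    "A *\<^sub>v v = e \<cdot>\<^sub>v v"
proof -
  obtain W where W: "W \<in> carrier_mat n (n - m)" "orthonormal_cols W"
    and Wu: "\<And>i. i < m \<Longrightarrow> mat_adjoint W *\<^sub>v u i = 0\<^sub>v (n - m)"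
    and span: "\<And>y. \<lbrakk>y \<in> carrier_vec n; \<And>i. i < m \<Longrightarrow> y \<bullet>c u i = 0; mat_adjoint W *\<^sub>v y = 0\<^sub>v (n - m)\<rbrakk>
      \<Longrightarrow> y = 0\<^sub>v n"
    using exists_orthogonal_complement[OF u] \<open>m < n\<close> by (metis less_imp_le_nat)
  obtain c e where c: "c \<in> carrier_vec (n - m)" "norm_sq c = 1"
    "(mat_adjoint W * A * W) *\<^sub>v c = e \<cdot>\<^sub>v c"
    using exists_unit_eigenvector[of "mat_adjoint W * A * W" "n - m"] W A(1) \<open>m < n\<close> by auto
  define v where "v = W *\<^sub>v c"
  have v: "v \<in> carrier_vec n" "norm_sq v = 1"
    using W c by (simp_all add: v_def norm_sq_orthonormal_cols)
  have vu: "v \<bullet>c u i = 0" if "i < m" for i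
    using that W Wu c(1) u(2) by (simp add: v_def cscalar_prod_mult_mat_vec)
  define y where "y = A *\<^sub>v v - e \<cdot>\<^sub>v v"
  have y: "y \<in> carrier_vec n" using A v by (simp add: y_def)
  moreover have "y \<bullet>c u i = 0" if i: "i < m" for i
  proof -
    obtain e' where "A *\<^sub>v u i = e' \<cdot>\<^sub>v u i" using eigenvector i by blast
    then have "(A *\<^sub>v v) \<bullet>c u i = 0"
      using A v(1) u(2)[OF i] vu[OF i] by (simp add: hermitian_cscalar_prod conjugate_smult_vec)
    then show ?thesis
      using A(1) v(1) u(2)[OF i] vu[OF i] by (simp add: y_def minus_scalar_prod_distrib[of _ n])
  qed
  moreover have "mat_adjoint W *\<^sub>v y = 0\<^sub>v (n - m)"
  proof -
    have "mat_adjoint W *\<^sub>v y = (mat_adjoint W * A * W) *\<^sub>v c - e \<cdot>\<^sub>v (mat_adjoint W *\<^sub>v (W *\<^sub>v c))"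
      using A(1) W(1) c(1)
      by (simp add: y_def v_def mult_minus_distrib_mat_vec[of _ "n - m" n]
          mult_mat_vec[of _ "n - m" n] mult_mat_vec_assoc)
    also have "\<dots> = 0\<^sub>v (n - m)" using c W by (simp add: orthonormal_cols_cancel_vec)
    finally show ?thesis .
  qed
  ultimately have "y = 0\<^sub>v n" by (rule span)
  then have "A *\<^sub>v v = e \<cdot>\<^sub>v v" using A(1) v(1) by (intro eq_vecI) (auto simp: y_def vec_eq_iff)
  then show ?thesis using that v vu by blast
qed

lemma hermitian_eigenvalue_eq:
  assumes A: "A \<in> carrier_mat n n" "hermitian_mat A" and v: "v \<in> carrier_vec n" "norm_sq v = 1"
    and eigenvector: "A *\<^sub>v v = e \<cdot>\<^sub>v v"
  shows "e = complex_of_real (quad_form A v)"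
proof -
  have vv: "v \<bullet>c v = 1" using v(2) by (simp add: cscalar_prod_self)
  have "e = (A *\<^sub>v v) \<bullet>c v" using v(1) vv by (simp add: eigenvector)
  moreover have "cnj e = v \<bullet>c (A *\<^sub>v v)"
    using v(1) vv by (simp add: eigenvector conjugate_smult_vec)
  ultimately have "cnj e = e" using hermitian_cscalar_prod[OF A(2)] A(1) v(1) by simp
  then show ?thesis using v(1) vv by (simp add: quad_form_def eigenvector complex_eq_iff)
qed

lemma hermitian_eigenfamily:
  assumes A: "A \<in> carrier_mat n n" "hermitian_mat A" and "m \<le> n"
  shows "\<exists>u. orthonormal_on {..<m} u \<and>
    (\<forall>i<m. u i \<in> carrier_vec n \<and> A *\<^sub>v u i = complex_of_real (quad_form A (u i)) \<cdot>\<^sub>v u i)"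
  using \<open>m \<le> n\<close>
proof (induction m)
  case 0
  show ?case by (simp add: orthonormal_on_def)
next
  case (Suc m)
  then obtain u where u: "orthonormal_on {..<m} u" "\<And>i. i < m \<Longrightarrow> u i \<in> carrier_vec n"
    and Au: "\<And>i. i < m \<Longrightarrow> A *\<^sub>v u i = complex_of_real (quad_form A (u i)) \<cdot>\<^sub>v u i" by auto
  obtain v e where v: "v \<in> carrier_vec n" "norm_sq v = 1" "\<And>i. i < m \<Longrightarrow> v \<bullet>c u i = 0"
    and "A *\<^sub>v v = e \<cdot>\<^sub>v v"
    using hermitian_exists_orthogonal_eigenvector[OF A u] Au Suc.prems by (metis Suc_le_lessD)
  then have Av: "A *\<^sub>v v = complex_of_real (quad_form A v) \<cdot>\<^sub>v v"
    using hermitian_eigenvalue_eq[OF A v(1,2)] by simp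
  have "u i \<bullet>c v = 0" if "i < m" for i
    using v(1,3) u(2)[OF that] that cscalar_prod_cnj[of "u i" v] by simp
  moreover have "v \<bullet>c v = 1" using v(2) by (simp add: cscalar_prod_self)
  ultimately have "orthonormal_on {..<Suc m} (u(m := v))"
    using u(1) v(3) by (auto simp: orthonormal_on_def less_Suc_eq)
  moreover have "(u(m := v)) i \<in> carrier_vec n \<and>
      A *\<^sub>v (u(m := v)) i = complex_of_real (quad_form A ((u(m := v)) i)) \<cdot>\<^sub>v (u(m := v)) i"
    if "i < Suc m" for i
    using that u(2) Au v(1) Av by (auto simp: less_Suc_eq)
  ultimately show ?case by blast
qed

lemma spectral_mat_eqI:
  assumes A: "A \<in> carrier_mat n n" and U: "U \<in> carrier_mat n n" "orthonormal_cols U"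
    and eigenvector: "\<And>j. j < n \<Longrightarrow> A *\<^sub>v col U j = complex_of_real (l j) \<cdot>\<^sub>v col U j"
  shows "A = spectral_mat U l"
proof -
  have "A * U = U * real_diag n l"
  proof (rule eq_matI)
    fix i j assume "i < dim_row (U * real_diag n l)" "j < dim_col (U * real_diag n l)"
    then have ij: "i < n" "j < n" using U by auto
    have "(A * U) $$ (i, j) = (A *\<^sub>v col U j) $ i"
      using ij A U(1) by (simp add: index_mult_mat index_mult_mat_vec)
    then show "(A * U) $$ (i, j) = (U * real_diag n l) $$ (i, j)"
      using ij U(1) by (simp add: eigenvector mult_real_diag_index)
  qed (use A U in auto)
  then have "spectral_mat U l = A * U * mat_adjoint U" using U(1) by (simp add: spectral_mat_def)
  also have "\<dots> = A * (U * mat_adjoint U)" using A U(1) by (intro mult_mat_assoc) auto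
  finally show ?thesis using A by (simp add: orthonormal_cols_right_inverse[OF U])
qed

lemma hermitian_diagonalization:
  fixes key :: "real \<Rightarrow> 'a :: linorder"
  assumes A: "A \<in> carrier_mat n n" "hermitian_mat A"
  obtains U l where "U \<in> carrier_mat n n" "orthonormal_cols U" "A = spectral_mat U l"
    "mono_on {..<n} (\<lambda>i. key (l i))"
proof -
  obtain u where u: "orthonormal_on {..<n} u" "\<And>i. i < n \<Longrightarrow> u i \<in> carrier_vec n"
    and Au: "\<And>i. i < n \<Longrightarrow> A *\<^sub>v u i = complex_of_real (quad_form A (u i)) \<cdot>\<^sub>v u i"
    using hermitian_eigenfamily[OF A order_refl] by blast
  define p where "p = sort_key (\<lambda>i. key (quad_form A (u i))) [0..<n]"
  define l where "l i = quad_form A (u (p ! i))" for i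
  have inj_p: "inj_on ((!) p) {..<n}" and p_less: "\<And>i. i < n \<Longrightarrow> p ! i < n"
    using nth_mem[of _ p] by (auto simp: p_def intro!: inj_on_nth)
  define U where "U = mat_of_cols n (map (\<lambda>i. u (p ! i)) [0..<n])"
  have "orthonormal_on {..<n} (\<lambda>i. u (p ! i))"
    using p_less by (intro orthonormal_on_reindex[OF u(1) inj_p]) auto
  then have U: "U \<in> carrier_mat n n" "orthonormal_cols U"
    using orthonormal_cols_mat_of_cols[of n "\<lambda>i. u (p ! i)" n] u(2) p_less by (simp_all add: U_def)
  have "A = spectral_mat U l"
    using u(2) p_less Au by (intro spectral_mat_eqI[OF A(1) U]) (simp add: U_def l_def)
  moreover have "mono_on {..<n} (\<lambda>i. key (l i))"
  proof (rule mono_onI)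
    fix i j assume "i \<in> {..<n}" "j \<in> {..<n}" "i \<le> j"
    then show "key (l i) \<le> key (l j)"
      using sorted_nth_mono[of "map (\<lambda>i. key (quad_form A (u i))) p" i j] by (simp add: p_def l_def)
  qed
  ultimately show ?thesis using that U by blast
qed

subsection \<open>Eigenvalue lists\<close>

lemma sort_desc_eqI:
  assumes "mset xs = mset ys" "sorted_wrt (\<ge>) ys"
  shows "sort_desc xs = ys"
proof -
  have "sort xs = rev ys" using assms by (intro properties_for_sort) (simp_all add: sorted_wrt_rev)
  then show ?thesis by (simp add: sort_desc_def)
qed

lemma sort_desc_map_antimono:
  assumes "antimono_on {..<n} f"
  shows "sort_desc (map f [0..<n]) = map f [0..<n]"
  using assms by (intro sort_desc_eqI) (auto simp: sorted_wrt_iff_nth_less monotone_on_def)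

lemma sort_desc_map_mono:
  assumes "mono_on {..<n} f"
  shows "sort_desc (map f [0..<n]) = rev (map f [0..<n])"
proof -
  have "sorted (map f [0..<n])" using assms by (auto simp: sorted_iff_nth_mono monotone_on_def)
  then show ?thesis by (simp add: sort_desc_def sorted_sort_id)
qed

lemma eigvals_eqI:
  assumes "char_poly M = prod_list (map (\<lambda>x. [:- complex_of_real x, 1:]) xs)"
    and "length xs = dim_row M"
  shows "eigvals M = sort_desc xs"
  unfolding eigvals_def
proof (rule the_equality)
  have "mset (map f (sort_desc xs)) = mset (map f xs)" for f :: "real \<Rightarrow> complex poly"
    by (simp add: sort_desc_def)
  then have "prod_list (map f (sort_desc xs)) = prod_list (map f xs)" for f :: "real \<Rightarrow> complex poly"
    by (metis prod_mset_prod_list)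
  then show "length (sort_desc xs) = dim_row M \<and> sorted_wrt (\<ge>) (sort_desc xs) \<and>
      char_poly M = prod_list (map (\<lambda>x. [:- complex_of_real x, 1:]) (sort_desc xs))"
    using assms by (simp add: sort_desc_def sorted_wrt_rev)
next
  fix ys
  assume ys: "length ys = dim_row M \<and> sorted_wrt (\<ge>) ys \<and>
      char_poly M = prod_list (map (\<lambda>x. [:- complex_of_real x, 1:]) ys)"
  have "proots (prod_list (map (\<lambda>x. [:- complex_of_real x, 1:]) zs)) =
      image_mset complex_of_real (mset zs)" for zs
  proof (induction zs)
    case (Cons z zs)
    have "(\<Prod>x\<leftarrow>zs. [:- complex_of_real x, 1:]) \<noteq> 0" by (auto simp: prod_list_zero_iff)
    with Cons show ?case by (simp add: proots_mult del: mult_pCons_left)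
  qed simp
  with ys assms(1) have "image_mset complex_of_real (mset xs) =
      image_mset complex_of_real (mset ys)"
    by metis
  then have "mset xs = mset ys" by (rule injD[OF multiset.inj_map, rotated]) (simp add: inj_def)
  with ys show "ys = sort_desc xs" by (simp add: sort_desc_eqI)
qed

lemma eigvals_spectral_mat:
  assumes U: "U \<in> carrier_mat n n" "orthonormal_cols U"
  shows "eigvals (spectral_mat U l) = sort_desc (map l [0..<n])"
proof (rule eigvals_eqI)
  have "similar_mat_wit (spectral_mat U l) (real_diag n l) U (mat_adjoint U)"
    using U orthonormal_cols_right_inverse[OF U]
    by (intro similar_mat_witI[of _ _ n]) (auto simp: spectral_mat_def orthonormal_cols_def)
  then have "char_poly (spectral_mat U l) = char_poly (real_diag n l)"
    by (intro char_poly_similar) (auto simp: similar_mat_def)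
  also have "\<dots> = (\<Prod>a\<leftarrow>diag_mat (real_diag n l). [:- a, 1:])"
    by (rule char_poly_upper_triangular[of _ n]) (auto simp: upper_triangular_def real_diag_index)
  also have "diag_mat (real_diag n l) = map complex_of_real (map l [0..<n])"
    by (simp add: diag_mat_def real_diag_index)
  finally show "char_poly (spectral_mat U l) =
      prod_list (map (\<lambda>x. [:- complex_of_real x, 1:]) (map l [0..<n]))"
    by (simp add: comp_def)
qed (use U in simp)

lemma hermitian_spectral_decomposition:
  assumes A: "A \<in> carrier_mat n n" "hermitian_mat A"
  obtains U where "U \<in> carrier_mat n n" "orthonormal_cols U" "A = spectral_mat U ((!) (eigvals A))"
    and "length (eigvals A) = n" "antimono_on {..<n} ((!) (eigvals A))"
proof -
  obtain U l where U: "U \<in> carrier_mat n n" "orthonormal_cols U" "A = spectral_mat U l"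
    and "mono_on {..<n} (\<lambda>i. - l i)"
    by (rule hermitian_diagonalization[OF A, of uminus])
  then have l: "antimono_on {..<n} l" by (simp add: monotone_on_def)
  then have eigvals: "eigvals A = map l [0..<n]"
    using U by (simp add: eigvals_spectral_mat sort_desc_map_antimono)
  have "real_diag n ((!) (eigvals A)) = real_diag n l"
    by (intro eq_matI) (auto simp: real_diag_index eigvals)
  then have "A = spectral_mat U ((!) (eigvals A))" using U by (simp add: spectral_mat_def)
  moreover have "antimono_on {..<n} ((!) (eigvals A))"
    using l by (simp add: eigvals monotone_on_def)
  moreover have "length (eigvals A) = n" by (simp add: eigvals)
  ultimately show ?thesis using that U(1,2) by blast
qed

lemma length_eigvals:
  assumes "A \<in> carrier_mat n n" "hermitian_mat A"
  shows "length (eigvals A) = n"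
  using hermitian_spectral_decomposition[OF assms] by metis

lemma eigvals_antimono:
  assumes "A \<in> carrier_mat n n" "hermitian_mat A"
  shows "antimono_on {..<n} ((!) (eigvals A))"
  using hermitian_spectral_decomposition[OF assms] by metis

lemma spr_eq:
  assumes "A \<in> carrier_mat n n" "hermitian_mat A" "0 < n"
  shows "spr A = eigvals A ! 0 - eigvals A ! (n - 1)"
proof -
  have "eigvals A \<noteq> []" using length_eigvals[OF assms(1,2)] assms(3) by auto
  then show ?thesis
    using length_eigvals[OF assms(1,2)] by (simp add: spr_def hd_conv_nth last_conv_nth)
qed

lemma spr_nonneg:
  assumes "A \<in> carrier_mat n n" "hermitian_mat A" "0 < n"
  shows "0 \<le> spr A"
  using assms eigvals_antimono[OF assms(1,2)] by (simp add: spr_eq monotone_on_def)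

lemma eigvals_unitary_conjugate:
  assumes "M \<in> carrier_mat n n" "U \<in> carrier_mat n n" "orthonormal_cols U"
  shows "eigvals (mat_adjoint U * M * U) = eigvals M"
proof -
  have "similar_mat_wit (mat_adjoint U * M * U) M (mat_adjoint U) U"
    using assms orthonormal_cols_right_inverse[OF assms(2,3)]
    by (intro similar_mat_witI[of _ _ n]) (auto simp: orthonormal_cols_def)
  then have "char_poly (mat_adjoint U * M * U) = char_poly M"
    by (intro char_poly_similar) (auto simp: similar_mat_def)
  then show ?thesis using assms by (simp add: eigvals_def)
qed

lemma sum_quad_form_orthonormal_basis:
  assumes A: "A \<in> carrier_mat n n" "hermitian_mat A"
    and V: "V \<in> carrier_mat n n" "orthonormal_cols V"
  shows "(\<Sum>i<n. quad_form A (col V i)) = (\<Sum>i<n. eigvals A ! i)"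
proof -
  obtain U where U: "U \<in> carrier_mat n n" "orthonormal_cols U"
    and AU: "A = spectral_mat U ((!) (eigvals A))"
    using hermitian_spectral_decomposition[OF A] by metis
  have "cmod (col V i \<bullet>c col U j) = cmod (col U j \<bullet>c col V i)" for i j
    using U V cscalar_prod_cnj[of "col V i" "col U j"] by simp
  then have weights_sum: "(\<Sum>i<n. (cmod (col V i \<bullet>c col U j))\<^sup>2) = 1" if "j < n" for j
    using that U parseval[OF V, of "col U j"] by (simp add: norm_sq_col)
  have "(\<Sum>i<n. quad_form A (col V i)) = (\<Sum>i<n. \<Sum>j<n. eigvals A ! j * (cmod (col V i \<bullet>c col U j))\<^sup>2)"
    using U V by (subst AU) (simp add: quad_form_spectral_mat)
  also have "\<dots> = (\<Sum>j<n. eigvals A ! j * (\<Sum>i<n. (cmod (col V i \<bullet>c col U j))\<^sup>2))"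
    by (subst sum.swap) (simp add: sum_distrib_left)
  finally show ?thesis using weights_sum by simp
qed

subsection \<open>Eigenvalue perturbation\<close>

lemma eigvals_mono_shift:
  assumes M: "M \<in> carrier_mat n n" "hermitian_mat M" and N: "N \<in> carrier_mat n n" "hermitian_mat N"
    and M_le: "\<And>v. v \<in> carrier_vec n \<Longrightarrow> quad_form M v \<le> quad_form N v + t * norm_sq v" and "i < n"
  shows "eigvals M ! i \<le> eigvals N ! i + t"
proof -
  obtain U where U: "U \<in> carrier_mat n n" "orthonormal_cols U"
    and M_eq: "M = spectral_mat U ((!) (eigvals M))"
    using hermitian_spectral_decomposition[OF M] by metis
  obtain W where W: "W \<in> carrier_mat n n" "orthonormal_cols W"
    and N_eq: "N = spectral_mat W ((!) (eigvals N))"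
    using hermitian_spectral_decomposition[OF N] by metis
  \<comment> \<open>The last \<open>n - 1 - i\<close> eigenvectors of \<open>M\<close> and the first \<open>i\<close> of \<open>N\<close> do not span.\<close>
  let ?S = "col U ` {i<..<n} \<union> col W ` {..<i}"
  have S: "?S \<subseteq> carrier_vec n" "finite ?S" using U(1) W(1) by auto
  have "card ?S \<le> card {i<..<n} + card {..<i}"
    by (intro order_trans[OF card_Un_le] add_mono card_image_le) auto
  then have "card ?S < n" using \<open>i < n\<close> by simp
  then obtain x where x: "x \<in> carrier_vec n" "norm_sq x = 1" "\<And>u. u \<in> ?S \<Longrightarrow> x \<bullet>c u = 0"
    using exists_unit_orthogonal[OF S] by blast
  have "j \<le> i" if "j < n" "x \<bullet>c col U j \<noteq> 0" for j
    using x(3)[of "col U j"] that by (force simp: not_le[symmetric])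
  then have "quad_form (spectral_mat U (\<lambda>_. eigvals M ! i)) x \<le> quad_form M x"
    using eigvals_antimono[OF M] \<open>i < n\<close>
    by (subst (2) M_eq, intro quad_form_spectral_mat_mono[OF U(1) x(1)])
      (auto simp: monotone_on_def)
  then have "eigvals M ! i \<le> quad_form M x"
    using x(2) by (simp add: quad_form_spectral_mat_const[OF U x(1)])
  also have "\<dots> \<le> quad_form N x + t" using M_le[OF x(1)] x(2) by simp
  also have "quad_form N x \<le> eigvals N ! i"
  proof -
    have "i \<le> j" if "x \<bullet>c col W j \<noteq> 0" for j
      using x(3)[of "col W j"] that by (force simp: not_le[symmetric])
    then have "quad_form N x \<le> quad_form (spectral_mat W (\<lambda>_. eigvals N ! i)) x"
      using eigvals_antimono[OF N] \<open>i < n\<close>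
      by (subst N_eq, intro quad_form_spectral_mat_mono[OF W(1) x(1)]) (auto simp: monotone_on_def)
    then show ?thesis using x(2) by (simp add: quad_form_spectral_mat_const[OF W x(1)])
  qed
  finally show ?thesis by simp
qed

lemma sum_eigvals_add_spectral_mat_le:
  assumes N: "N \<in> carrier_mat n n" "hermitian_mat N"
    and V: "V \<in> carrier_mat n n" "orthonormal_cols V"
    and p: "\<And>i. i < n \<Longrightarrow> 0 \<le> p i" and I: "I \<subseteq> {..<n}"
  shows "(\<Sum>i\<in>I. eigvals (N + spectral_mat V p) ! i - eigvals N ! i) \<le> (\<Sum>i<n. p i)"
proof -
  define Q where "Q = N + spectral_mat V p"
  have Q: "Q \<in> carrier_mat n n" "hermitian_mat Q"
    using N V(1) hermitian_spectral_mat[of V p]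
    by (auto simp: Q_def hermitian_mat_def mat_adjoint_add)
  have quad_form_Q: "quad_form Q v = quad_form N v + quad_form (spectral_mat V p) v"
    if "v \<in> carrier_vec n" for v
    using quad_form_add_mat[OF N(1) _ that] V(1) by (simp add: Q_def)
  have "0 \<le> quad_form (spectral_mat V p) v" if "v \<in> carrier_vec n" for v
    using quad_form_spectral_mat_mono[OF V(1) that, of "\<lambda>_. 0" p] p
    by (simp add: quad_form_spectral_mat_const[OF V that])
  \<comment> \<open>All gaps are nonnegative, so a partial sum is at most the full one, a difference of traces.\<close>
  then have "eigvals N ! i \<le> eigvals Q ! i" if "i < n" for i
    using eigvals_mono_shift[OF N Q, of 0] quad_form_Q that by simp
  then have "(\<Sum>i\<in>I. eigvals Q ! i - eigvals N ! i) \<le> (\<Sum>i<n. eigvals Q ! i - eigvals N ! i)"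
    using I by (intro sum_mono2) auto
  also have "\<dots> = (\<Sum>i<n. quad_form Q (col V i) - quad_form N (col V i))"
    by (simp add: sum_subtractf sum_quad_form_orthonormal_basis[OF Q V]
        sum_quad_form_orthonormal_basis[OF N V])
  also have "\<dots> = (\<Sum>i<n. p i)" using V by (simp add: quad_form_Q quad_form_spectral_mat_col)
  finally show ?thesis unfolding Q_def .
qed

lemma sum_eigvals_diff_le:
  fixes t :: real
  assumes M: "M \<in> carrier_mat n n" "hermitian_mat M" and N: "N \<in> carrier_mat n n" "hermitian_mat N"
    and V: "V \<in> carrier_mat n n" "orthonormal_cols V"
    and M_le: "\<And>v. v \<in> carrier_vec n \<Longrightarrow>
      quad_form M v \<le> quad_form N v + quad_form (spectral_mat V d) v"
    and I: "I \<subseteq> {..<n}"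
  shows "(\<Sum>i\<in>I. eigvals M ! i - eigvals N ! i) \<le> t * card I + (\<Sum>i<n. max 0 (d i - t))"
proof -
  \<comment> \<open>the positive part of \<open>D - t\<close> for \<open>D = spectral_mat V d\<close>, so that \<open>M \<le> N + P + t\<close>\<close>
  define P where "P = spectral_mat V (\<lambda>i. max 0 (d i - t))"
  have P: "P \<in> carrier_mat n n" "hermitian_mat P"
    using V(1) by (simp_all add: P_def hermitian_spectral_mat)
  then have Q: "N + P \<in> carrier_mat n n" "hermitian_mat (N + P)"
    using N by (auto simp: hermitian_mat_def mat_adjoint_add)
  have "eigvals M ! i \<le> eigvals (N + P) ! i + t" if "i < n" for i
  proof (rule eigvals_mono_shift[OF M Q _ that])
    fix v :: "complex vec" assume v: "v \<in> carrier_vec n"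
    have "quad_form (spectral_mat V d) v \<le> quad_form (spectral_mat V (\<lambda>i. max 0 (d i - t) + t)) v"
      by (rule quad_form_spectral_mat_mono[OF V(1) v]) simp
    also have "\<dots> = quad_form P v + t * norm_sq v"
      using V v
      by (simp add: P_def quad_form_spectral_mat distrib_right sum.distrib parseval
          flip: sum_distrib_left)
    finally show "quad_form M v \<le> quad_form (N + P) v + t * norm_sq v"
      using M_le[OF v] quad_form_add_mat[OF N(1) P(1) v] by simp
  qed
  then have "(\<Sum>i\<in>I. eigvals M ! i - eigvals N ! i) \<le>
      (\<Sum>i\<in>I. t + (eigvals (N + P) ! i - eigvals N ! i))"
    using I by (intro sum_mono) (force simp: algebra_simps)
  also have "\<dots> = t * card I + (\<Sum>i\<in>I. eigvals (N + P) ! i - eigvals N ! i)"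
    by (simp add: sum.distrib)
  also have "(\<Sum>i\<in>I. eigvals (N + P) ! i - eigvals N ! i) \<le> (\<Sum>i<n. max 0 (d i - t))"
    unfolding P_def by (rule sum_eigvals_add_spectral_mat_le[OF N V _ I]) simp
  finally show ?thesis by simp
qed

lemma sum_abs_eigvals_diff_le:
  fixes t :: real
  assumes M: "M \<in> carrier_mat n n" "hermitian_mat M" and N: "N \<in> carrier_mat n n" "hermitian_mat N"
    and V: "V \<in> carrier_mat n n" "orthonormal_cols V" and diff: "M - N = spectral_mat V d"
    and "0 \<le> t" and I: "I \<subseteq> {..<n}"
  shows "(\<Sum>i\<in>I. \<bar>eigvals M ! i - eigvals N ! i\<bar>) \<le> t * card I + (\<Sum>i<n. max 0 (\<bar>d i\<bar> - t))"
proof -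
  have quad_form_d: "quad_form (spectral_mat V d) v = quad_form M v - quad_form N v"
    if "v \<in> carrier_vec n" for v
    using quad_form_diff_mat[OF M(1) N(1) that] by (simp add: diff)
  then have quad_form_neg_d:
    "quad_form (spectral_mat V (\<lambda>i. - d i)) v = quad_form N v - quad_form M v"
    if "v \<in> carrier_vec n" for v
    using V(1) that by (simp add: quad_form_spectral_mat sum_negf)
  let ?gap = "\<lambda>i. eigvals M ! i - eigvals N ! i"
  define Ipos where "Ipos = {i \<in> I. 0 \<le> ?gap i}"
  have finite_I: "finite I" using I finite_subset by blast
  then have "card I = card Ipos + card (I - Ipos)"
    by (subst card_Diff_subset) (auto simp: Ipos_def card_mono)
  then have card_I: "real (card I) = card Ipos + card (I - Ipos)" by simp
  have "(\<Sum>i\<in>I. \<bar>?gap i\<bar>) = (\<Sum>i\<in>I - Ipos. \<bar>?gap i\<bar>) + (\<Sum>i\<in>Ipos. \<bar>?gap i\<bar>)"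
    by (rule sum.subset_diff) (use finite_I in \<open>auto simp: Ipos_def\<close>)
  also have "(\<Sum>i\<in>Ipos. \<bar>?gap i\<bar>) = (\<Sum>i\<in>Ipos. ?gap i)" by (intro sum.cong) (auto simp: Ipos_def)
  also have "\<dots> \<le> t * card Ipos + (\<Sum>i<n. max 0 (d i - t))"
    using quad_form_d I by (intro sum_eigvals_diff_le[OF M N V]) (auto simp: Ipos_def)
  also have "(\<Sum>i\<in>I - Ipos. \<bar>?gap i\<bar>) = (\<Sum>i\<in>I - Ipos. eigvals N ! i - eigvals M ! i)"
    by (intro sum.cong) (auto simp: Ipos_def)
  also have "\<dots> \<le> t * card (I - Ipos) + (\<Sum>i<n. max 0 (- d i - t))"
    using quad_form_neg_d I by (intro sum_eigvals_diff_le[OF N M V]) auto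
  finally have "(\<Sum>i\<in>I. \<bar>?gap i\<bar>) \<le> t * card I + (\<Sum>i<n. max 0 (d i - t) + max 0 (- d i - t))"
    by (simp add: card_I sum.distrib algebra_simps)
  also have "(\<Sum>i<n. max 0 (d i - t) + max 0 (- d i - t)) = (\<Sum>i<n. max 0 (\<bar>d i\<bar> - t))"
    using \<open>0 \<le> t\<close> by (intro sum.cong) (auto simp: max_def)
  finally show ?thesis .
qed

lemma mirsky_inequality:
  assumes M: "M \<in> carrier_mat n n" "hermitian_mat M" and N: "N \<in> carrier_mat n n" "hermitian_mat N"
    and I: "I \<subseteq> {..<n}"
  obtains V where "V \<in> carrier_mat n n" "orthonormal_cols V"
    "(\<Sum>i\<in>I. \<bar>eigvals M ! i - eigvals N ! i\<bar>) \<le>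
      (\<Sum>l<card I. \<bar>quad_form M (col V l) - quad_form N (col V l)\<bar>)"
proof -
  have D: "M - N \<in> carrier_mat n n" "hermitian_mat (M - N)"
    using M N by (auto simp: hermitian_mat_def mat_adjoint_minus)
  obtain V d where V: "V \<in> carrier_mat n n" "orthonormal_cols V"
    and diff: "M - N = spectral_mat V d"
    and mono_d: "mono_on {..<n} (\<lambda>i. - \<bar>d i\<bar>)"
    by (rule hermitian_diagonalization[OF D, of "\<lambda>x. - \<bar>x\<bar>"])
  have card_le: "card I \<le> n" using card_mono[OF _ I] by simp
  \<comment> \<open>The threshold turning the bound of the previous lemma into the sum of the largest \<open>\<bar>d i\<bar>\<close>.\<close>
  define t where "t = (if card I < n then \<bar>d (card I)\<bar> else 0)"
  have above: "t \<le> \<bar>d i\<bar>" if "i < card I" for i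
    using mono_d that card_le by (auto simp: t_def monotone_on_def)
  have below: "\<bar>d i\<bar> \<le> t" if "card I \<le> i" "i < n" for i
    using mono_d that by (auto simp: t_def monotone_on_def)
  have "(\<Sum>i\<in>I. \<bar>eigvals M ! i - eigvals N ! i\<bar>) \<le> t * card I + (\<Sum>i<n. max 0 (\<bar>d i\<bar> - t))"
    by (rule sum_abs_eigvals_diff_le[OF M N V diff _ I]) (simp add: t_def)
  also have "(\<Sum>i<n. max 0 (\<bar>d i\<bar> - t)) = (\<Sum>i<card I. \<bar>d i\<bar> - t)"
    using above below card_le
    by (intro sum.mono_neutral_cong_right) (auto simp: max_absorb1 max_absorb2)
  also have "t * card I + \<dots> = (\<Sum>i<card I. \<bar>d i\<bar>)" by (simp add: sum_subtractf)
  also have "\<dots> = (\<Sum>l<card I. \<bar>quad_form M (col V l) - quad_form N (col V l)\<bar>)"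
  proof (intro sum.cong refl)
    fix l assume "l \<in> {..<card I}"
    then have l: "l < n" using card_le by simp
    then have "quad_form M (col V l) - quad_form N (col V l) = quad_form (M - N) (col V l)"
      using quad_form_diff_mat[OF M(1) N(1)] V(1) by simp
    then show "\<bar>d l\<bar> = \<bar>quad_form M (col V l) - quad_form N (col V l)\<bar>"
      by (simp add: diff quad_form_spectral_mat_col[OF V l])
  qed
  finally show ?thesis using that V by blast
qed

subsection \<open>Singular values and principal angles\<close>

lemma orthogonal_cols_factor:
  assumes H: "H \<in> carrier_mat k k" "mat_adjoint H * H = real_diag k (\<lambda>i. (c i)\<^sup>2)"
  obtains U where "U \<in> carrier_mat k k" "orthonormal_cols U" "H = U * real_diag k c"
proof -
  have cols: "col H i \<bullet>c col H j = (if i = j then complex_of_real ((c i)\<^sup>2) else 0)"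
    if "i < k" "j < k" for i j
    using that H mat_adjoint_mult_index[of H H j i] by (auto simp: real_diag_index)
  define P where "P = {i. i < k \<and> c i \<noteq> 0}"
  define u where "u i = complex_of_real (1 / c i) \<cdot>\<^sub>v col H i" for i
  have "orthonormal_on P u"
    using H(1) cols
    by (auto simp: orthonormal_on_def P_def u_def conjugate_smult_vec power2_eq_square)
  then obtain u' where u': "orthonormal_on {..<k} u'" "\<And>i. i < k \<Longrightarrow> u' i \<in> carrier_vec k"
    and u'_eq: "\<And>i. i \<in> P \<Longrightarrow> u' i = u i"
    using orthonormal_on_extend[of P u k] H(1) by (auto simp: P_def u_def)
  define U where "U = mat_of_cols k (map u' [0..<k])"
  have U: "U \<in> carrier_mat k k" "orthonormal_cols U"
    using orthonormal_cols_mat_of_cols[OF u'] by (simp_all add: U_def)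
  have "H = U * real_diag k c"
  proof (rule eq_matI)
    fix i j assume "i < dim_row (U * real_diag k c)" "j < dim_col (U * real_diag k c)"
    then have ij: "i < k" "j < k" using U by auto
    show "H $$ (i, j) = (U * real_diag k c) $$ (i, j)"
    proof (cases "c j = 0")
      case True
      then have "col H j = 0\<^sub>v k" using cols[OF ij(2) ij(2)] ij H(1) by simp
      then have "H $$ (i, j) = 0" using ij H(1) by (metis carrier_matD index_col index_zero_vec(1))
      then show ?thesis using True ij U by (simp add: mult_real_diag_index)
    next
      case False
      then have "U $$ (i, j) = H $$ (i, j) / complex_of_real (c j)"
        using ij H(1) u'_eq[of j] by (simp add: U_def mat_of_cols_index P_def u_def)
      then show ?thesis using False ij U by (simp add: mult_real_diag_index)
    qed
  qed (use H U in auto)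
  then show ?thesis using that U by blast
qed

lemma singular_value_decomposition:
  assumes G: "G \<in> carrier_mat k k"
  obtains U V c where "U \<in> carrier_mat k k" "orthonormal_cols U"
    "V \<in> carrier_mat k k" "orthonormal_cols V"
    "G = U * real_diag k c * mat_adjoint V" "\<And>i. i < k \<Longrightarrow> 0 \<le> c i" "mono_on {..<k} c"
proof -
  let ?B = "mat_adjoint G * G"
  have B: "?B \<in> carrier_mat k k" "hermitian_mat ?B"
    using G by (simp_all add: hermitian_mat_def mat_adjoint_mult)
  obtain V l where V: "V \<in> carrier_mat k k" "orthonormal_cols V" and BV: "?B = spectral_mat V l"
    and mono: "mono_on {..<k} l"
    by (rule hermitian_diagonalization[OF B, of "\<lambda>x. x"])
  have nonneg: "0 \<le> l i" if "i < k" for i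
  proof -
    have "l i = Re ((?B *\<^sub>v col V i) \<bullet>c col V i)"
      using quad_form_spectral_mat_col[OF V that] by (simp add: BV quad_form_def)
    also have "\<dots> = norm_sq (G *\<^sub>v col V i)"
      using G V(1) that
      by (simp add: mult_mat_vec_assoc cscalar_prod_mult_mat_vec[of _ "mat_adjoint G"]
          cscalar_prod_self)
    finally show ?thesis by simp
  qed
  have "mat_adjoint (G * V) * (G * V) = mat_adjoint V * (?B * V)"
    using G V(1) by (simp add: mat_adjoint_mult mult_mat_assoc)
  also have "\<dots> = real_diag k l"
    using V by (simp add: BV spectral_mat_def mult_mat_assoc orthonormal_cols_cancel)
      (simp add: orthonormal_cols_def)
  also have "\<dots> = real_diag k (\<lambda>i. (sqrt (l i))\<^sup>2)"
    using nonneg by (intro eq_matI) (auto simp: real_diag_index)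
  finally have orth: "mat_adjoint (G * V) * (G * V) = real_diag k (\<lambda>i. (sqrt (l i))\<^sup>2)" .
  obtain U where U: "U \<in> carrier_mat k k" "orthonormal_cols U"
    and GV: "G * V = U * real_diag k (\<lambda>i. sqrt (l i))"
    by (rule orthogonal_cols_factor[OF mult_carrier_mat[OF G V(1)] orth])
  have "G = G * V * mat_adjoint V"
    using G V(1) by (simp add: mult_mat_assoc orthonormal_cols_right_inverse[OF V])
  then show ?thesis
    using that[OF U V, of "\<lambda>i. sqrt (l i)"] GV nonneg mono by (simp add: monotone_on_def)
qed

lemma sing_vals_up_eq:
  assumes U: "U \<in> carrier_mat k k" "orthonormal_cols U"
    and V: "V \<in> carrier_mat k k" "orthonormal_cols V"
    and G: "G = U * real_diag k c * mat_adjoint V" and c: "\<And>i. i < k \<Longrightarrow> 0 \<le> c i" "mono_on {..<k} c"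
  shows "sing_vals_up G = map c [0..<k]"
proof -
  have "mat_adjoint G * G = spectral_mat V (\<lambda>i. (c i)\<^sup>2)"
    using U V
    by (simp add: G spectral_mat_def mat_adjoint_mult mult_mat_assoc orthonormal_cols_cancel
        real_diag_mult_mat power2_eq_square)
  moreover have "mono_on {..<k} (\<lambda>i. (c i)\<^sup>2)"
    using c by (auto simp: monotone_on_def intro!: power_mono)
  ultimately have "eigvals (mat_adjoint G * G) = rev (map (\<lambda>i. (c i)\<^sup>2) [0..<k])"
    using V by (simp add: eigvals_spectral_mat sort_desc_map_mono)
  then show ?thesis using c(1) by (simp add: sing_vals_up_def sing_vals_def rev_map)
qed

lemma principal_angles_commute:
  assumes X: "X \<in> carrier_mat n k" and Y: "Y \<in> carrier_mat n k"
  shows "principal_angles Y X = principal_angles X Y"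
proof -
  obtain U V c where U: "U \<in> carrier_mat k k" "orthonormal_cols U"
    and V: "V \<in> carrier_mat k k" "orthonormal_cols V"
    and G: "mat_adjoint X * Y = U * real_diag k c * mat_adjoint V"
    and c: "\<And>i. i < k \<Longrightarrow> 0 \<le> c i" "mono_on {..<k} c"
    by (rule singular_value_decomposition[of "mat_adjoint X * Y" k]) (use X Y in auto)
  have "mat_adjoint Y * X = mat_adjoint (mat_adjoint X * Y)"
    using X Y by (simp add: mat_adjoint_mult)
  also have "\<dots> = V * real_diag k c * mat_adjoint U"
    using U(1) V(1) by (simp add: G mat_adjoint_mult mult_mat_assoc)
  finally have "sing_vals_up (mat_adjoint Y * X) = map c [0..<k]"
    by (rule sing_vals_up_eq[OF V U _ c])
  moreover have "sing_vals_up (mat_adjoint X * Y) = map c [0..<k]"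
    by (rule sing_vals_up_eq[OF U V G c])
  ultimately show ?thesis by (simp add: principal_angles_def)
qed

subsection \<open>Contractions\<close>

definition contraction :: "complex mat \<Rightarrow> bool" where
  "contraction K \<longleftrightarrow> (\<forall>v \<in> carrier_vec (dim_col K). norm_sq (K *\<^sub>v v) \<le> norm_sq v)"

lemma contractionD: "contraction K \<Longrightarrow> dim_vec v = dim_col K \<Longrightarrow> norm_sq (K *\<^sub>v v) \<le> norm_sq v"
  by (simp add: contraction_def)

lemma contraction_one: "contraction (1\<^sub>m n)"
  by (simp add: contraction_def)

lemma contraction_mult:
  assumes "contraction K" "contraction L" "dim_col K = dim_row L"
  shows "contraction (K * L)"
  unfolding contraction_def
proof
  fix v :: "complex vec" assume "v \<in> carrier_vec (dim_col (K * L))"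
  then show "norm_sq (K * L *\<^sub>v v) \<le> norm_sq v"
    using assms contractionD[of K "L *\<^sub>v v"] contractionD[of L v] by (simp add: mult_mat_vec_assoc)
qed

lemma orthonormal_cols_contraction: "orthonormal_cols V \<Longrightarrow> contraction V"
  by (simp add: contraction_def norm_sq_orthonormal_cols)

lemma contraction_adjoint:
  assumes K: "contraction K"
  shows "contraction (mat_adjoint K)"
  unfolding contraction_def
proof
  fix v :: "complex vec" assume v: "v \<in> carrier_vec (dim_col (mat_adjoint K))"
  let ?w = "mat_adjoint K *\<^sub>v v"
  \<comment> \<open>\<open>2 |K\<^sup>H v|\<^sup>2 = 2 Re \<langle>K K\<^sup>H v, v\<rangle> \<le> |K\<^sup>H v|\<^sup>2 + |v|\<^sup>2\<close>\<close>
  have "norm_sq ?w = Re (?w \<bullet>c ?w)" by (simp add: cscalar_prod_self)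
  also have "?w \<bullet>c ?w = (K *\<^sub>v ?w) \<bullet>c v" using v by (simp add: cscalar_prod_mult_mat_vec)
  finally have "2 * norm_sq ?w \<le> norm_sq (K *\<^sub>v ?w) + norm_sq v"
    using Re_cscalar_prod_le[of "K *\<^sub>v ?w" v] v by simp
  also have "norm_sq (K *\<^sub>v ?w) \<le> norm_sq ?w" using K by (simp add: contractionD)
  finally show "norm_sq ?w \<le> norm_sq v" by simp
qed

lemma contraction_real_diag_iff: "contraction (real_diag n f) \<longleftrightarrow> (\<forall>i<n. \<bar>f i\<bar> \<le> 1)"
proof
  assume f: "contraction (real_diag n f)"
  show "\<forall>i<n. \<bar>f i\<bar> \<le> 1"
  proof (intro allI impI)
    fix i assume i: "i < n"
    have "real_diag n f *\<^sub>v unit_vec n i = complex_of_real (f i) \<cdot>\<^sub>v unit_vec n i"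
      using i by (intro eq_vecI) (auto simp: real_diag_mult_vec_index)
    then have "(f i)\<^sup>2 \<le> 1"
      using contractionD[OF f, of "unit_vec n i"] i by (simp add: norm_sq_smult)
    then show "\<bar>f i\<bar> \<le> 1" by (simp add: abs_square_le_1)
  qed
next
  assume f: "\<forall>i<n. \<bar>f i\<bar> \<le> 1"
  show "contraction (real_diag n f)"
    unfolding contraction_def
  proof
    fix v :: "complex vec" assume "v \<in> carrier_vec (dim_col (real_diag n f))"
    then have v: "v \<in> carrier_vec n" by simp
    have "(\<Sum>i<n. (f i)\<^sup>2 * (cmod (v $ i))\<^sup>2) \<le> (\<Sum>i<n. (cmod (v $ i))\<^sup>2)"
      using f by (intro sum_mono mult_left_le_one_le) (auto simp: abs_square_le_1)
    then show "norm_sq (real_diag n f *\<^sub>v v) \<le> norm_sq v"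
      using v by (simp add: norm_sq_real_diag norm_sq_def[of v])
  qed
qed

lemma contraction_quad_form_le:
  assumes "contraction B" "B \<in> carrier_mat n n" "v \<in> carrier_vec n"
  shows "\<bar>quad_form B v\<bar> \<le> norm_sq v"
  using assms Re_cscalar_prod_le[of "B *\<^sub>v v" v] contractionD[of B v]
  by (simp add: quad_form_def abs_mult)

lemma hermitian_centered_contraction:
  assumes A: "A \<in> carrier_mat n n" "hermitian_mat A" and n: "0 < n"
  obtains B m where "B \<in> carrier_mat n n" "hermitian_mat B" "contraction B"
    "\<And>v. v \<in> carrier_vec n \<Longrightarrow> quad_form A v = m * norm_sq v + spr A / 2 * quad_form B v"
proof -
  let ?a = "(!) (eigvals A)"
  obtain U where U: "U \<in> carrier_mat n n" "orthonormal_cols U" and A_eq: "A = spectral_mat U ?a"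
    using hermitian_spectral_decomposition[OF A] by metis
  define r where "r = spr A / 2"
  define m where "m = (?a 0 + ?a (n - 1)) / 2"
  define b where "b i = (if r = 0 then 0 else (?a i - m) / r)" for i
  have deviation: "\<bar>?a i - m\<bar> \<le> r" if "i < n" for i
  proof -
    have "?a i \<le> ?a 0" "?a (n - 1) \<le> ?a i"
      using eigvals_antimono[OF A] that by (auto simp: monotone_on_def)
    then show ?thesis unfolding m_def r_def spr_eq[OF A n] abs_le_iff by (simp add: field_simps)
  qed
  then have a_eq: "?a i = m + r * b i" if "i < n" for i using that by (auto simp: b_def)
  have "\<bar>b i\<bar> \<le> 1" if "i < n" for i
    using deviation[OF that] by (cases "r = 0") (auto simp: b_def)
  then have "contraction (real_diag n b)" by (simp add: contraction_real_diag_iff)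
  then have contr: "contraction (spectral_mat U b)"
    using U
    by (simp add: spectral_mat_def contraction_mult contraction_adjoint
        orthonormal_cols_contraction)
  have "quad_form A v = m * norm_sq v + spr A / 2 * quad_form (spectral_mat U b) v"
    if v: "v \<in> carrier_vec n" for v
  proof -
    have "quad_form A v = (\<Sum>i<n. (m + r * b i) * (cmod (v \<bullet>c col U i))\<^sup>2)"
      using v U by (subst A_eq) (simp add: quad_form_spectral_mat a_eq)
    then show ?thesis
      using v U
      by (simp add: quad_form_spectral_mat parseval r_def distrib_right sum.distrib mult.assoc
          flip: sum_distrib_left sum_divide_distrib)
  qed
  then show ?thesis using that[of "spectral_mat U b" m] U hermitian_spectral_mat contr by simp
qed

lemma weighted_sum_le_sum_lessThan:
  fixes f w :: "nat \<Rightarrow> real"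
  assumes f: "\<And>i. i < k \<Longrightarrow> 0 \<le> f i" "antimono_on {..<k} f"
    and w: "\<And>i. i < k \<Longrightarrow> 0 \<le> w i" "\<And>i. i < k \<Longrightarrow> w i \<le> 1" "(\<Sum>i<k. w i) \<le> j" and "j \<le> k"
  shows "(\<Sum>i<k. f i * w i) \<le> (\<Sum>i<j. f i)"
proof -
  \<comment> \<open>\<open>t\<close> separates the \<open>j\<close> largest values of \<open>f\<close> from the others.\<close>
  define t where "t = (if j < k then f j else 0)"
  have "f i * w i \<le> t * w i + (if i < j then f i - t else 0)" if "i < k" for i
  proof (cases "i < j")
    case True
    then have "t \<le> f i" using f that \<open>j \<le> k\<close> by (auto simp: t_def monotone_on_def)
    then have "(f i - t) * w i \<le> f i - t" using w(2)[OF that] by (simp add: mult_left_le)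
    then show ?thesis using True by (simp add: algebra_simps)
  next
    case False
    then have "f i \<le> t" using f(2) that by (auto simp: t_def monotone_on_def)
    then show ?thesis using False w(1)[OF that] by (simp add: mult_right_mono)
  qed
  then have "(\<Sum>i<k. f i * w i) \<le> (\<Sum>i<k. t * w i + (if i < j then f i - t else 0))"
    by (intro sum_mono) simp
  also have "\<dots> = t * (\<Sum>i<k. w i) + (\<Sum>i<j. f i - t)"
  proof -
    have "(\<Sum>i<k. if i < j then f i - t else 0) = (\<Sum>i<j. f i - t)"
      using \<open>j \<le> k\<close> by (intro sum.mono_neutral_cong_right) auto
    then show ?thesis by (simp add: sum.distrib sum_distrib_left)
  qed
  also have "\<dots> \<le> (\<Sum>i<j. f i)"
    using mult_left_mono[OF w(3), of t] f(1) by (simp add: sum_subtractf t_def mult.commute)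
  finally show ?thesis .
qed

lemma sum_quad_form_contraction_le:
  assumes f: "\<And>i. i < k \<Longrightarrow> 0 \<le> f i" "antimono_on {..<k} f"
    and V: "V \<in> carrier_mat k k" "orthonormal_cols V" and K: "K \<in> carrier_mat k k" "contraction K"
    and "j \<le> k"
  shows "(\<Sum>l<j. quad_form (real_diag k f) (K *\<^sub>v col V l)) \<le> (\<Sum>i<j. f i)"
proof -
  define w where "w p = (\<Sum>l<j. (cmod ((K *\<^sub>v col V l) $ p))\<^sup>2)" for p
  have w_le_1: "w p \<le> 1" if p: "p < k" for p
  proof -
    let ?x = "col (mat_adjoint K) p"
    have "cmod ((K *\<^sub>v col V l) $ p) = cmod (?x \<bullet>c col V l)" if "l < k" for l
      using that K V p mat_adjoint_mult_vec_index[of "col V l" "mat_adjoint K" p]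
        cscalar_prod_cnj[of "col V l" ?x] by simp
    then have bessel: "(\<Sum>l<k. (cmod ((K *\<^sub>v col V l) $ p))\<^sup>2) = norm_sq ?x"
      using parseval[OF V, of ?x] K by simp
    have "w p \<le> (\<Sum>l<k. (cmod ((K *\<^sub>v col V l) $ p))\<^sup>2)"
      unfolding w_def using \<open>j \<le> k\<close> by (intro sum_mono2) auto
    also note bessel
    also have "?x = mat_adjoint K *\<^sub>v unit_vec k p"
      using K p by (intro eq_vecI) (auto simp: index_mult_mat_vec)
    also have "norm_sq \<dots> \<le> 1"
      using contractionD[OF contraction_adjoint[OF K(2)], of "unit_vec k p"] K(1) p by simp
    finally show ?thesis .
  qed
  have "(\<Sum>p<k. w p) = (\<Sum>l<j. norm_sq (K *\<^sub>v col V l))"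
    unfolding w_def using K by (subst sum.swap) (simp add: norm_sq_def)
  also have "\<dots> \<le> (\<Sum>l<j. 1)"
  proof (rule sum_mono)
    fix l assume "l \<in> {..<j}"
    then show "norm_sq (K *\<^sub>v col V l) \<le> 1"
      using V K(1) \<open>j \<le> k\<close> contractionD[OF K(2), of "col V l"] by (simp add: norm_sq_col)
  qed
  finally have "(\<Sum>p<k. w p) \<le> j" by simp
  moreover have "(\<Sum>l<j. quad_form (real_diag k f) (K *\<^sub>v col V l)) = (\<Sum>p<k. f p * w p)"
    unfolding w_def using K
    by (simp add: quad_form_real_diag sum_distrib_left sum.swap[of _ "{..<j}"])
  ultimately show ?thesis
    using weighted_sum_le_sum_lessThan[OF f _ w_le_1 _ \<open>j \<le> k\<close>] by (simp add: w_def sum_nonneg)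
qed

subsection \<open>Ritz values of aligned bases\<close>

lemma quad_form_diff_contracted_le:
  assumes B: "B \<in> carrier_mat k k" "hermitian_mat B" and c: "\<And>i. i < k \<Longrightarrow> c i \<le> 1"
    and y: "y \<in> carrier_vec k"
  defines "K \<equiv> B * real_diag k (\<lambda>i. (1 + c i) / 2)"
  shows "\<bar>quad_form B y - quad_form B (real_diag k c *\<^sub>v y)\<bar> \<le>
    quad_form (real_diag k (\<lambda>i. 1 - c i)) y + quad_form (real_diag k (\<lambda>i. 1 - c i)) (K *\<^sub>v y)"
proof -
  let ?Cy = "real_diag k c *\<^sub>v y" and ?E = "\<lambda>i. 1 - c i"
  define S where "S = real_diag k (\<lambda>i. sqrt (1 - c i))"
  have dims: "K \<in> carrier_mat k k" "S \<in> carrier_mat k k" "mat_adjoint S = S"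
    using B(1) by (simp_all add: K_def S_def)
  have norm_S: "norm_sq (S *\<^sub>v v) = quad_form (real_diag k ?E) v" if "v \<in> carrier_vec k" for v
    using that c by (simp add: S_def norm_sq_real_diag quad_form_real_diag)
  have "y + ?Cy = complex_of_real 2 \<cdot>\<^sub>v (real_diag k (\<lambda>i. (1 + c i) / 2) *\<^sub>v y)"
    using y by (intro eq_vecI) (auto simp: real_diag_mult_vec_index algebra_simps)
  then have sum: "B *\<^sub>v (y + ?Cy) = complex_of_real 2 \<cdot>\<^sub>v (K *\<^sub>v y)"
    using B(1) y by (simp add: K_def mult_mat_vec_assoc mult_mat_vec[of _ k k])
  have diff: "y - ?Cy = S *\<^sub>v (S *\<^sub>v y)"
    using y c
    by (intro eq_vecI)
      (auto simp: S_def real_diag_mult_vec_index algebra_simps simp flip: of_real_mult)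
  have "quad_form B y - quad_form B ?Cy = Re ((B *\<^sub>v (y + ?Cy)) \<bullet>c (y - ?Cy))"
    using quad_form_diff_vec[OF B y] y by simp
  also have "\<dots> = 2 * Re ((K *\<^sub>v y) \<bullet>c (S *\<^sub>v (S *\<^sub>v y)))"
    unfolding sum diff using y dims by simp
  also have "(K *\<^sub>v y) \<bullet>c (S *\<^sub>v (S *\<^sub>v y)) = (S *\<^sub>v (K *\<^sub>v y)) \<bullet>c (S *\<^sub>v y)"
    using y dims by (simp add: cscalar_prod_mult_mat_vec[of "K *\<^sub>v y"])
  finally have "\<bar>quad_form B y - quad_form B ?Cy\<bar> \<le> norm_sq (S *\<^sub>v (K *\<^sub>v y)) + norm_sq (S *\<^sub>v y)"
    using Re_cscalar_prod_le[of "S *\<^sub>v (K *\<^sub>v y)" "S *\<^sub>v y"] by simp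
  then show ?thesis using y dims by (simp add: norm_S)
qed

lemma quad_form_invariant_split:
  assumes A: "A \<in> carrier_mat n n" "hermitian_mat A"
    and X: "X \<in> carrier_mat n k" and inv: "invariant_subspace A (col_space X)"
    and u: "u \<in> carrier_vec k" and z: "z \<in> carrier_vec n" "mat_adjoint X *\<^sub>v z = 0\<^sub>v k"
  shows "quad_form A (X *\<^sub>v u + z) = quad_form A (X *\<^sub>v u) + quad_form A z"
proof (rule quad_form_add_orthogonal[OF A])
  have "X *\<^sub>v u \<in> col_space X" using X u by (auto simp: col_space_def)
  with inv have "A *\<^sub>v (X *\<^sub>v u) \<in> col_space X" by (simp add: invariant_subspace_def)
  then obtain w where w: "w \<in> carrier_vec k" "A *\<^sub>v (X *\<^sub>v u) = X *\<^sub>v w"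
    using X by (auto simp: col_space_def)
  then show "(A *\<^sub>v (X *\<^sub>v u)) \<bullet>c z = 0" using X z by (simp add: cscalar_prod_mult_mat_vec)
qed (use X u z in auto)

lemma aligned_residual:
  assumes X: "X \<in> carrier_mat n k" "orthonormal_cols X"
    and Y: "Y \<in> carrier_mat n k" "orthonormal_cols Y"
    and XY: "mat_adjoint X * Y = real_diag k c" and y: "y \<in> carrier_vec k"
  obtains z where "z \<in> carrier_vec n" "Y *\<^sub>v y = X *\<^sub>v (real_diag k c *\<^sub>v y) + z"
    "mat_adjoint X *\<^sub>v z = 0\<^sub>v k"
    "norm_sq y = norm_sq (real_diag k c *\<^sub>v y) + norm_sq z"
proof -
  let ?Cy = "real_diag k c *\<^sub>v y"
  define z where "z = Y *\<^sub>v y - X *\<^sub>v ?Cy"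
  have z: "z \<in> carrier_vec n" using X Y by (simp add: z_def)
  have Yy: "Y *\<^sub>v y = X *\<^sub>v ?Cy + z" using X(1) Y(1) by (intro eq_vecI) (auto simp: z_def)
  have "mat_adjoint X *\<^sub>v z = (mat_adjoint X * Y) *\<^sub>v y - ?Cy"
    using X Y y
    by (simp add: z_def mult_minus_distrib_mat_vec[of _ k n] mult_mat_vec_assoc
        orthonormal_cols_cancel_vec)
  then have Xz: "mat_adjoint X *\<^sub>v z = 0\<^sub>v k" by (simp add: XY)
  then have "(1\<^sub>m n *\<^sub>v (X *\<^sub>v ?Cy)) \<bullet>c z = 0"
    using X(1) z by (simp add: cscalar_prod_mult_mat_vec)
  then have "norm_sq (Y *\<^sub>v y) = norm_sq (X *\<^sub>v ?Cy) + norm_sq z"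
    using quad_form_add_orthogonal[of "1\<^sub>m n" n "X *\<^sub>v ?Cy" z] X(1) z
    by (simp add: Yy quad_form_one hermitian_mat_def)
  then have "norm_sq y = norm_sq ?Cy + norm_sq z"
    using X Y y by (simp add: norm_sq_orthonormal_cols)
  with z Yy Xz show ?thesis by (rule that)
qed

lemma ritz_quad_form_diff_le:
  assumes A: "A \<in> carrier_mat n n" "hermitian_mat A"
    and B: "B \<in> carrier_mat n n" "hermitian_mat B" "contraction B"
    and AB: "\<And>v. v \<in> carrier_vec n \<Longrightarrow> quad_form A v = m * norm_sq v + r * quad_form B v" and "0 \<le> r"
    and X: "X \<in> carrier_mat n k" "orthonormal_cols X"
    and Y: "Y \<in> carrier_mat n k" "orthonormal_cols Y"
    and XY: "mat_adjoint X * Y = real_diag k c" and c: "\<And>i. i < k \<Longrightarrow> c i \<le> 1"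
    and inv: "invariant_subspace A (col_space X)" and y: "y \<in> carrier_vec k"
  defines "E \<equiv> real_diag k (\<lambda>i. 1 - c i)"
    and "K \<equiv> mat_adjoint X * B * X * real_diag k (\<lambda>i. (1 + c i) / 2)"
  shows "\<bar>quad_form (mat_adjoint X * A * X) y - quad_form (mat_adjoint Y * A * Y) y\<bar> \<le>
    r * (quad_form E y + quad_form E (K *\<^sub>v y) + quad_form (real_diag k (\<lambda>i. 1 - (c i)\<^sup>2)) y)"
proof -
  let ?Cy = "real_diag k c *\<^sub>v y" and ?B1 = "mat_adjoint X * B * X"
  have B1: "?B1 \<in> carrier_mat k k" "hermitian_mat ?B1"
    using B X hermitian_mat_congruence[of B X] by auto
  obtain z where z: "z \<in> carrier_vec n" and Yy: "Y *\<^sub>v y = X *\<^sub>v ?Cy + z"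
    and Xz: "mat_adjoint X *\<^sub>v z = 0\<^sub>v k"
    and norm_y: "norm_sq y = norm_sq ?Cy + norm_sq z"
    by (rule aligned_residual[OF X Y XY y])
  have norm_z: "norm_sq z = quad_form (real_diag k (\<lambda>i. 1 - (c i)\<^sup>2)) y"
    using norm_y by (simp flip: norm_sq_diff_real_diag[OF y])
  have "quad_form (mat_adjoint X * A * X) y - quad_form (mat_adjoint Y * A * Y) y =
      quad_form A (X *\<^sub>v y) - (quad_form A (X *\<^sub>v ?Cy) + quad_form A z)"
    unfolding quad_form_congruence[OF A(1) X(1) y] quad_form_congruence[OF A(1) Y(1) y] Yy
    using quad_form_invariant_split[OF A X(1) inv _ z Xz, of ?Cy] by simp
  also have "\<dots> = r * (quad_form B (X *\<^sub>v y) - quad_form B (X *\<^sub>v ?Cy) - quad_form B z)"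
    using X y z norm_y by (simp add: AB norm_sq_orthonormal_cols algebra_simps)
  also have "\<dots> = r * (quad_form ?B1 y - quad_form ?B1 ?Cy - quad_form B z)"
    using quad_form_congruence[OF B(1) X(1)] y by simp
  finally have "\<bar>quad_form (mat_adjoint X * A * X) y - quad_form (mat_adjoint Y * A * Y) y\<bar> =
      r * \<bar>quad_form ?B1 y - quad_form ?B1 ?Cy - quad_form B z\<bar>"
    using \<open>0 \<le> r\<close> by (simp add: abs_mult)
  also have "\<dots> \<le> r * (\<bar>quad_form ?B1 y - quad_form ?B1 ?Cy\<bar> + \<bar>quad_form B z\<bar>)"
    using \<open>0 \<le> r\<close> by (intro mult_left_mono) auto
  also have "\<dots> \<le> r * (quad_form E y + quad_form E (K *\<^sub>v y) +
      quad_form (real_diag k (\<lambda>i. 1 - (c i)\<^sup>2)) y)"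
    using quad_form_diff_contracted_le[OF B1 c y] contraction_quad_form_le[OF B(3,1) z]
      norm_z \<open>0 \<le> r\<close>
    unfolding E_def K_def by (intro mult_left_mono add_mono) auto
  finally show ?thesis .
qed

lemma sum_ritz_quad_form_diff_le:
  assumes A: "A \<in> carrier_mat n n" "hermitian_mat A" and n: "0 < n"
    and X: "X \<in> carrier_mat n k" "orthonormal_cols X"
    and Y: "Y \<in> carrier_mat n k" "orthonormal_cols Y"
    and XY: "mat_adjoint X * Y = real_diag k c"
    and c: "\<And>i. i < k \<Longrightarrow> 0 \<le> c i" "\<And>i. i < k \<Longrightarrow> c i \<le> 1" "mono_on {..<k} c"
    and inv: "invariant_subspace A (col_space X)"
    and V: "V \<in> carrier_mat k k" "orthonormal_cols V" and "j \<le> k"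
  shows "(\<Sum>l<j. \<bar>quad_form (mat_adjoint X * A * X) (col V l) -
      quad_form (mat_adjoint Y * A * Y) (col V l)\<bar>) \<le>
    (\<Sum>p<j. spr A * (1 - c p + (1 - (c p)\<^sup>2) / 2))"
proof -
  obtain B m where B: "B \<in> carrier_mat n n" "hermitian_mat B" "contraction B"
    and A_eq: "\<And>v. v \<in> carrier_vec n \<Longrightarrow> quad_form A v = m * norm_sq v + spr A / 2 * quad_form B v"
    using hermitian_centered_contraction[OF A n] by metis
  have r: "0 \<le> spr A / 2" using spr_nonneg[OF A n] by simp
  let ?e = "\<lambda>i. 1 - c i" and ?s = "\<lambda>i. 1 - (c i)\<^sup>2"
  define K where "K = mat_adjoint X * B * X * real_diag k (\<lambda>i. (1 + c i) / 2)"
  have K: "K \<in> carrier_mat k k" using X(1) by (simp add: K_def)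
  have "contraction (real_diag k (\<lambda>i. (1 + c i) / 2))"
    using c(1,2) by (force simp: contraction_real_diag_iff abs_le_iff)
  then have "contraction K"
    using B X by (simp add: K_def contraction_mult contraction_adjoint orthonormal_cols_contraction)
  have nonneg: "0 \<le> ?e i" "0 \<le> ?s i" if "i < k" for i
    using c(1,2)[OF that] by (auto simp: power_le_one)
  have antimono: "antimono_on {..<k} ?e" "antimono_on {..<k} ?s"
    using c by (auto simp: monotone_on_def intro!: power_mono)
  have one_col: "1\<^sub>m k *\<^sub>v col V l = col V l" if "l < k" for l using V(1) that by simp
  have "(\<Sum>l<j. \<bar>quad_form (mat_adjoint X * A * X) (col V l) -
        quad_form (mat_adjoint Y * A * Y) (col V l)\<bar>) \<le>
      (\<Sum>l<j. spr A / 2 * (quad_form (real_diag k ?e) (1\<^sub>m k *\<^sub>v col V l) +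
        quad_form (real_diag k ?e) (K *\<^sub>v col V l) +
        quad_form (real_diag k ?s) (1\<^sub>m k *\<^sub>v col V l)))"
    using ritz_quad_form_diff_le[OF A B A_eq r X Y XY c(2) inv] V(1) \<open>j \<le> k\<close>
    by (intro sum_mono) (simp add: one_col K_def)
  also have "\<dots> \<le> spr A / 2 * ((\<Sum>p<j. ?e p) + (\<Sum>p<j. ?e p) + (\<Sum>p<j. ?s p))"
    unfolding sum_distrib_left[symmetric] sum.distrib
    using nonneg antimono V K \<open>contraction K\<close> \<open>j \<le> k\<close> r
    by (intro mult_left_mono add_mono sum_quad_form_contraction_le contraction_one) auto
  also have "\<dots> = (\<Sum>p<j. spr A * (1 - c p + (1 - (c p)\<^sup>2) / 2))"
    unfolding sum.distrib[symmetric] sum_distrib_left by (intro sum.cong) (auto simp: field_simps)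
  finally show ?thesis .
qed

subsection \<open>Weak submajorization\<close>

lemma sum_list_take_sort_desc:
  assumes "j \<le> length xs"
  obtains I where "I \<subseteq> {..<length xs}" "card I = j"
    "sum_list (take j (sort_desc xs)) = (\<Sum>i\<in>I. xs ! i)"
proof -
  have "mset (sort_desc xs) = mset xs" by (simp add: sort_desc_def)
  then obtain p where p: "p permutes {..<length xs}" "permute_list p xs = sort_desc xs"
    by (rule mset_eq_permutation)
  have inj: "inj_on p {..<j}" using permutes_inj[OF p(1)] by (rule inj_on_subset) simp
  have "sum_list (take j (sort_desc xs)) = (\<Sum>i<j. take j (sort_desc xs) ! i)"
    using assms by (simp add: sum_list_sum_nth sort_desc_def atLeast0LessThan)
  also have "\<dots> = (\<Sum>i<j. xs ! p i)"
    using assms by (intro sum.cong) (auto simp: permute_list_nth[OF p(1)] simp flip: p(2))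
  also have "\<dots> = (\<Sum>i\<in>p ` {..<j}. xs ! i)" using inj by (simp add: sum.reindex)
  finally have "sum_list (take j (sort_desc xs)) = (\<Sum>i\<in>p ` {..<j}. xs ! i)" .
  moreover have "p ` {..<j} \<subseteq> {..<length xs}"
    using permutes_image[OF p(1)] assms by (metis image_mono lessThan_subset_iff)
  ultimately show ?thesis using that[of "p ` {..<j}"] inj by (simp add: card_image)
qed

lemma weak_submajI:
  assumes "length xs = length ys" "sorted_wrt (\<ge>) ys"
    and sum_le: "\<And>I. I \<subseteq> {..<length xs} \<Longrightarrow> (\<Sum>i\<in>I. xs ! i) \<le> (\<Sum>p<card I. ys ! p)"
  shows "weak_submaj xs ys"
  unfolding weak_submaj_def
proof (intro conjI ballI)
  fix j assume "j \<in> {1..length xs}"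
  then obtain I where I: "I \<subseteq> {..<length xs}" "card I = j"
    "sum_list (take j (sort_desc xs)) = (\<Sum>i\<in>I. xs ! i)"
    using sum_list_take_sort_desc[of j xs] by auto
  have "j \<le> length ys" using I(1,2) card_mono[of "{..<length xs}" I] assms(1) by simp
  have "sum_list (take j (sort_desc xs)) \<le> (\<Sum>p<j. ys ! p)" using sum_le[OF I(1)] I(2,3) by simp
  also have "\<dots> = sum_list (take j (sort_desc ys))"
    using \<open>j \<le> length ys\<close>
    by (simp add: sort_desc_eqI[OF refl assms(2)] sum_list_sum_nth atLeast0LessThan)
  finally show "sum_list (take j (sort_desc xs)) \<le> sum_list (take j (sort_desc ys))" .
qed (rule assms(1))

subsection \<open>The majorization bound for Ritz values\<close>

lemma col_space_mult_subset:
  assumes "dim_col X = dim_row U"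
  shows "col_space (X * U) \<subseteq> col_space X"
proof
  fix v assume "v \<in> col_space (X * U)"
  then obtain w where "dim_vec w = dim_col U" "v = X * U *\<^sub>v w" by (auto simp: col_space_def)
  then have "v = X *\<^sub>v (U *\<^sub>v w)" using assms by (simp add: mult_mat_vec_assoc)
  moreover have "U *\<^sub>v w \<in> carrier_vec (dim_col X)" using assms by simp
  ultimately show "v \<in> col_space X" unfolding col_space_def by blast
qed

lemma col_space_mult_unitary:
  assumes X: "X \<in> carrier_mat n k" and U: "U \<in> carrier_mat k k" "orthonormal_cols U"
  shows "col_space (X * U) = col_space X"
proof
  show "col_space (X * U) \<subseteq> col_space X" using X U by (simp add: col_space_mult_subset)
  have "X * U * mat_adjoint U = X"
    using X U by (simp add: mult_mat_assoc orthonormal_cols_right_inverse[OF U])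
  then show "col_space X \<subseteq> col_space (X * U)"
    using col_space_mult_subset[of "X * U" "mat_adjoint U"] U(1) by simp
qed

lemma exists_aligned_bases:
  assumes X: "X \<in> carrier_mat n k" "orthonormal_cols X"
    and Y: "Y \<in> carrier_mat n k" "orthonormal_cols Y"
  obtains U V c where "U \<in> carrier_mat k k" "orthonormal_cols U"
    "V \<in> carrier_mat k k" "orthonormal_cols V"
    "mat_adjoint (X * U) * (Y * V) = real_diag k c"
    "principal_angles X Y = map (\<lambda>i. arccos (c i)) [0..<k]"
    "\<And>i. i < k \<Longrightarrow> 0 \<le> c i" "\<And>i. i < k \<Longrightarrow> c i \<le> 1" "mono_on {..<k} c"
proof -
  obtain U V c where U: "U \<in> carrier_mat k k" "orthonormal_cols U"
    and V: "V \<in> carrier_mat k k" "orthonormal_cols V"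
    and XY: "mat_adjoint X * Y = U * real_diag k c * mat_adjoint V"
    and c: "\<And>i. i < k \<Longrightarrow> 0 \<le> c i" "mono_on {..<k} c"
    by (rule singular_value_decomposition[of "mat_adjoint X * Y" k]) (use X Y in auto)
  have "mat_adjoint (X * U) * (Y * V) = mat_adjoint U * (mat_adjoint X * Y * V)"
    using X Y U V by (simp add: mat_adjoint_mult mult_mat_assoc)
  also have "\<dots> = real_diag k c"
    using U V
    by (simp add: XY mult_mat_assoc orthonormal_cols_cancel) (simp add: orthonormal_cols_def)
  finally have aligned: "mat_adjoint (X * U) * (Y * V) = real_diag k c" .
  have "contraction (mat_adjoint (X * U) * (Y * V))"
    using X Y U V
    by (simp add: contraction_mult contraction_adjoint orthonormal_cols_contraction
        orthonormal_cols_mult)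
  then have "c i \<le> 1" if "i < k" for i
    using that by (auto simp: aligned contraction_real_diag_iff abs_le_iff)
  moreover have "principal_angles X Y = map (\<lambda>i. arccos (c i)) [0..<k]"
    by (simp add: principal_angles_def sing_vals_up_eq[OF U V XY c])
  ultimately show ?thesis using that[OF U V aligned] c by blast
qed

lemma eigvals_ritz_unitary:
  assumes "A \<in> carrier_mat n n" "X \<in> carrier_mat n k" "U \<in> carrier_mat k k" "orthonormal_cols U"
  shows "eigvals (mat_adjoint (X * U) * A * (X * U)) = eigvals (mat_adjoint X * A * X)"
proof -
  have "mat_adjoint (X * U) * A * (X * U) = mat_adjoint U * (mat_adjoint X * A * X) * U"
    using assms by (simp add: mat_adjoint_mult mult_mat_assoc)
  then show ?thesis using assms eigvals_unitary_conjugate[of "mat_adjoint X * A * X" k U] by simp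
qed

lemma aligned_ritz_values_weak_submaj:
  assumes A: "A \<in> carrier_mat n n" "hermitian_mat A"
    and X: "X \<in> carrier_mat n k" "orthonormal_cols X"
    and Y: "Y \<in> carrier_mat n k" "orthonormal_cols Y"
    and XY: "mat_adjoint X * Y = real_diag k c"
    and c: "\<And>i. i < k \<Longrightarrow> 0 \<le> c i" "\<And>i. i < k \<Longrightarrow> c i \<le> 1" "mono_on {..<k} c"
    and inv: "invariant_subspace A (col_space X)"
  shows "weak_submaj
     (map (\<lambda>(a, b). \<bar>a - b\<bar>)
        (zip (eigvals (mat_adjoint X * A * X)) (eigvals (mat_adjoint Y * A * Y))))
     (map (\<lambda>p. spr A * (1 - c p + (1 - (c p)\<^sup>2) / 2)) [0..<k])"
    (is "weak_submaj ?gaps (map ?bound _)")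
proof (rule weak_submajI)
  let ?M = "mat_adjoint X * A * X" and ?N = "mat_adjoint Y * A * Y"
  have M: "?M \<in> carrier_mat k k" "hermitian_mat ?M" and N: "?N \<in> carrier_mat k k" "hermitian_mat ?N"
    using A X Y hermitian_mat_congruence[of A X] hermitian_mat_congruence[of A Y] by auto
  note len = length_eigvals[OF M] length_eigvals[OF N]
  show "length ?gaps = length (map ?bound [0..<k])" by (simp add: len)
  have n: "0 < n" if "0 < k"
    using norm_sq_col[OF X(2), of 0] X(1) that by (cases "n = 0") (auto simp: norm_sq_def)
  have "?bound j \<le> ?bound i" if "i < j" "j < k" for i j
  proof -
    have "c i \<le> c j" "(c i)\<^sup>2 \<le> (c j)\<^sup>2"
      using c that by (auto simp: monotone_on_def intro!: power_mono)
    then have "1 - c j + (1 - (c j)\<^sup>2) / 2 \<le> 1 - c i + (1 - (c i)\<^sup>2) / 2"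
      by (intro add_mono diff_left_mono divide_right_mono) auto
    then show ?thesis using spr_nonneg[OF A n] that by (intro mult_left_mono) auto
  qed
  then show "sorted_wrt (\<ge>) (map ?bound [0..<k])" by (simp add: sorted_wrt_iff_nth_less)
  fix I assume "I \<subseteq> {..<length ?gaps}"
  then have I: "I \<subseteq> {..<k}" by (simp add: len)
  then have card_le: "card I \<le> k" using card_mono[of "{..<k}" I] by simp
  show "(\<Sum>i\<in>I. ?gaps ! i) \<le> (\<Sum>p<card I. map ?bound [0..<k] ! p)"
  proof (cases "k = 0")
    case False
    obtain V where V: "V \<in> carrier_mat k k" "orthonormal_cols V"
      and gaps_le: "(\<Sum>i\<in>I. \<bar>eigvals ?M ! i - eigvals ?N ! i\<bar>) \<le>
        (\<Sum>l<card I. \<bar>quad_form ?M (col V l) - quad_form ?N (col V l)\<bar>)"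
      by (rule mirsky_inequality[OF M N I])
    have "(\<Sum>i\<in>I. ?gaps ! i) = (\<Sum>i\<in>I. \<bar>eigvals ?M ! i - eigvals ?N ! i\<bar>)"
      using I len by (intro sum.cong) auto
    also note gaps_le
    also have "(\<Sum>l<card I. \<bar>quad_form ?M (col V l) - quad_form ?N (col V l)\<bar>) \<le>
        (\<Sum>p<card I. ?bound p)"
      using False n by (intro sum_ritz_quad_form_diff_le[OF A _ X Y XY c inv V card_le]) auto
    also have "\<dots> = (\<Sum>p<card I. map ?bound [0..<k] ! p)" using card_le by (intro sum.cong) auto
    finally show ?thesis .
  qed (use I in simp)
qed

lemma ritz_values_weak_submaj:
  assumes A: "A \<in> carrier_mat n n" "hermitian_mat A"
    and X: "X \<in> carrier_mat n k" "orthonormal_cols X"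
    and Y: "Y \<in> carrier_mat n k" "orthonormal_cols Y"
    and inv: "invariant_subspace A (col_space X)"
  shows "weak_submaj
     (map (\<lambda>(a, b). \<bar>a - b\<bar>)
        (zip (eigvals (mat_adjoint X * A * X)) (eigvals (mat_adjoint Y * A * Y))))
     (map (\<lambda>t. spr A * (1 - cos t + (sin t)\<^sup>2 / 2)) (principal_angles X Y))"
    (is "weak_submaj ?gaps _")
proof -
  obtain U V c where U: "U \<in> carrier_mat k k" "orthonormal_cols U"
    and V: "V \<in> carrier_mat k k" "orthonormal_cols V"
    and aligned: "mat_adjoint (X * U) * (Y * V) = real_diag k c"
    and angles: "principal_angles X Y = map (\<lambda>i. arccos (c i)) [0..<k]"
    and c: "\<And>i. i < k \<Longrightarrow> 0 \<le> c i" "\<And>i. i < k \<Longrightarrow> c i \<le> 1" "mono_on {..<k} c"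
    using exists_aligned_bases[OF X Y] by blast
  have XU: "X * U \<in> carrier_mat n k" "orthonormal_cols (X * U)"
    and YV: "Y * V \<in> carrier_mat n k" "orthonormal_cols (Y * V)"
    using X Y U V by (simp_all add: orthonormal_cols_mult)
  have "invariant_subspace A (col_space (X * U))"
    using inv by (simp add: col_space_mult_unitary[OF X(1) U])
  then have "weak_submaj ?gaps
      (map (\<lambda>p. spr A * (1 - c p + (1 - (c p)\<^sup>2) / 2)) [0..<k])"
    using aligned_ritz_values_weak_submaj[OF A XU YV aligned c]
    by (simp only: eigvals_ritz_unitary[OF A(1) X(1) U] eigvals_ritz_unitary[OF A(1) Y(1) V])
  also have "map (\<lambda>p. spr A * (1 - c p + (1 - (c p)\<^sup>2) / 2)) [0..<k] =
      map (\<lambda>t. spr A * (1 - cos t + (sin t)\<^sup>2 / 2)) (principal_angles X Y)"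
    using c(1,2) by (simp add: angles sin_squared_eq order_trans[of "-1" 0])
  finally show ?thesis .
qed

theorem theorem3p3:
  fixes A X Y :: "complex mat" and n k :: nat
  assumes "A \<in> carrier_mat n n" and "hermitian_mat A"
    and "X \<in> carrier_mat n k" and "Y \<in> carrier_mat n k"
    and "orthonormal_cols X" and "orthonormal_cols Y"
    and "invariant_subspace A (col_space X) \<or> invariant_subspace A (col_space Y)"
  shows "weak_submaj
     (map (\<lambda>(a, b). \<bar>a - b\<bar>)
        (zip (eigvals (mat_adjoint X * A * X)) (eigvals (mat_adjoint Y * A * Y))))
     (map (\<lambda>t. spr A * (1 - cos t + (sin t)\<^sup>2 / 2)) (principal_angles X Y))"
  using assms(7)
proof
  assume "invariant_subspace A (col_space X)"
  then show ?thesis by (rule ritz_values_weak_submaj[OF assms(1,2,3,5,4,6)])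
next
  assume inv: "invariant_subspace A (col_space Y)"
  have swap: "map (\<lambda>(a, b). \<bar>a - b\<bar>) (zip xs ys) =
      map (\<lambda>(a, b). \<bar>a - b\<bar>) (zip ys xs)" for xs ys :: "real list"
    by (subst zip_commute) (auto simp: abs_minus_commute)
  show ?thesis
    using ritz_values_weak_submaj[OF assms(1,2,4,6,3,5) inv]
    by (simp only: principal_angles_commute[OF assms(3,4)]
        swap[of "eigvals (mat_adjoint Y * A * Y)"])
qed

end
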